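(* Let $0\le u_0<u_1<\infty$. There exists a weakly mixing space-time stationary random field $u(t,x)$, $(t,x)\in\mathbb{R}\times\mathbb{R}$, whose realizations are $C^\infty$ functions with $u(t,x)\in[u_0,u_1]$ for all $(t,x)$, such that with probability $1$, for every $(t_0,x_0)\in\mathbb{R}^2$ the solution $(x_{(t_0,x_0)}(t))_{t\ge t_0}$ of $\dot x(t)=u(t,x(t))$, $x(t_0)=x_0$, satisfies $$\liminf_{t\to+\infty}\frac{x_{(t_0,x_0)}(t)}{t}=u_0,\qquad \limsup_{t\to+\infty}\frac{x_{(t_0,x_0)}(t)}{t}=u_1 .$$
   Context: A random field $u$ on $\mathbb{R}^2$ (coordinates $(t,x)$) is space-time stationary and weakly mixing if $u^\omega(t,x)=\bar u(T_{(t,x)}\omega)$ for a measurable $\bar u$ and a weakly mixing measure-preserving $\mathbb{R}^2$-action $(T_g)$ on a probability space $(\Omega,\mathcal{F},P)$. Weak mixing of an $\mathbb{R}^2$-action means: for all measurable $A,B$, $\lim_{R\to\infty}(2R)^{-2}\int_{|g|\le R}|P(T_gA\cap B)-P(A)P(B)|\,dg=0$, with $|g|=\max_i|g_i|$; equivalently the diagonal action on $\Omega\times\Omega$ with $P\otimes P$ is ergodic. *)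

theory Defs
  imports "HOL-Analysis.Analysis" "HOL-Probability.Probability"
begin

fun Ck :: "nat \<Rightarrow> (real \<times> real \<Rightarrow> real) \<Rightarrow> bool" where
  "Ck 0 f = continuous_on UNIV f"
| "Ck (Suc k) f = (\<exists>f'. (\<forall>z. (f has_derivative f' z) (at z)) \<and> (\<forall>v. Ck k (\<lambda>z. f' z v)))"

definition smooth_fun :: "(real \<times> real \<Rightarrow> real) \<Rightarrow> bool" where
  "smooth_fun f \<longleftrightarrow> (\<forall>k. Ck k f)"

definition mp_action :: "'a measure \<Rightarrow> (real \<times> real \<Rightarrow> 'a \<Rightarrow> 'a) \<Rightarrow> bool" where
  "mp_action M T \<longleftrightarrow>
     prob_space M \<and>
     (\<lambda>(g, \<omega>). T g \<omega>) \<in> measurable (borel \<Otimes>\<^sub>M M) M \<and>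
     (\<forall>g. T g \<in> measurable M M \<and> distr M M (T g) = M) \<and>
     (\<forall>\<omega>\<in>space M. T 0 \<omega> = \<omega>) \<and>
     (\<forall>g h. \<forall>\<omega>\<in>space M. T (g + h) \<omega> = T g (T h \<omega>))"

definition weakly_mixing :: "'a measure \<Rightarrow> (real \<times> real \<Rightarrow> 'a \<Rightarrow> 'a) \<Rightarrow> bool" where
  "weakly_mixing M T \<longleftrightarrow> mp_action M T \<and>
     (\<forall>A\<in>sets M. \<forall>B\<in>sets M.
        ((\<lambda>R. (1 / (2 * R)^2) *
           (LINT g : {g :: real \<times> real. max \<bar>fst g\<bar> \<bar>snd g\<bar> \<le> R} | lborel.
              \<bar>measure M (T g -` A \<inter> space M \<inter> B) - measure M A * measure M B\<bar>))
         \<longlongrightarrow> 0) at_top)"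

definition is_solution :: "(real \<times> real \<Rightarrow> real) \<Rightarrow> real \<Rightarrow> real \<Rightarrow> (real \<Rightarrow> real) \<Rightarrow> bool" where
  "is_solution u t0 x0 x \<longleftrightarrow> x t0 = x0 \<and>
     (\<forall>t\<ge>t0. (x has_real_derivative u (t, x t)) (at t within {t0..}))"

end

(* Take two independent Poisson point sets on the real line and let (t, x) translate the first by
   x - u0 t and the second by u1 t - x; the resulting action is weakly mixing because void events
   over distant windows are independent. Both linear forms are nondecreasing along every
   trajectory of a field with values in [u0, u1]. At scale n, an empty stretch of length L_n in the
   first (n even) or second (n odd) point set marks a strip in which the field equals u0
   respectively u1, and larger scales override smaller ones. Along such a strip the corresponding
   linear form is constant on trajectories, so no trajectory can cross it. The lengths L_n grow so
   fast that, by Borel-Cantelli, for all large n every trajectory meets a strip of scale n within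
   distance W_n and no strip of a larger scale before time n W_n. Hence x(t) is within W_n plus a
   constant of u0 t or of u1 t at t = n W_n. *)

theory Submission
  imports Defs
begin

section \<open>Smooth functions and a mollifier\<close>

text \<open>The almost sure statement must hold for uncountably many starting points (t0, x0) at
  once. Hence both Borel-Cantelli events speak of \<omega> alone, and (t0, x0) enters only through a
  constant C that is eventually below n. This is why the search for a gap starts at n and why larger
  scales are kept out of the range n^2 W_n, which is n times the time n W_n.

  An interval of length l is free of points with probability exp(-l). About n exp(L_n + 3) disjoint
  trials therefore all fail with probability at most exp(-n), which fixes W_n. Next, L_(n+1) is 2
  n^2 W_n + n + 3, so that scale n + 1 is kept out by one point in a window of length n + 1, which
  is missing with probability exp(-(n + 1)).

  Mixing is only weak: translation along (1, u0) or (1, u1) fixes one of the two point sets, so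
  correlations do not decay there, but group elements near these directions have density zero.

  Smoothness is demanded of every realization, not of almost every one. This forces a default field
  outside a set of good configurations that is exactly shift invariant.\<close>

lemma Ck_Suc_imp: "Ck (Suc k) f \<Longrightarrow> Ck k f"
proof (induction k arbitrary: f)
  case 0
  then show ?case
    by (auto simp: continuous_on_eq_continuous_at intro: has_derivative_continuous)
next
  case (Suc k)
  then obtain f' where "\<And>z. (f has_derivative f' z) (at z)" "\<And>v. Ck (Suc k) (\<lambda>z. f' z v)"
    by (metis Ck.simps(2))
  then show ?case using Suc.IH by (metis Ck.simps(2))
qed

lemma Ck_const: "Ck k (\<lambda>z. c)"
proof (induction k arbitrary: c)
  case (Suc k)
  have "((\<lambda>z. c) has_derivative (\<lambda>v. 0)) (at z)" for z :: "real \<times> real" by simp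
  then show ?case using Suc by (auto intro!: exI[of _ "\<lambda>z v. 0"])
qed simp

lemma Ck_add: "Ck k f \<Longrightarrow> Ck k g \<Longrightarrow> Ck k (\<lambda>z. f z + g z)"
proof (induction k arbitrary: f g)
  case 0
  then show ?case by (auto intro: continuous_on_add)
next
  case (Suc k)
  obtain f' where f': "\<And>z. (f has_derivative f' z) (at z)" "\<And>v. Ck k (\<lambda>z. f' z v)"
    using Suc.prems(1) by (metis Ck.simps(2))
  obtain g' where g': "\<And>z. (g has_derivative g' z) (at z)" "\<And>v. Ck k (\<lambda>z. g' z v)"
    using Suc.prems(2) by (metis Ck.simps(2))
  show ?case
    using f' g' Suc.IH
    by (auto intro!: exI[of _ "\<lambda>z v. f' z v + g' z v"] has_derivative_add)
qed

lemma Ck_mult: "Ck k f \<Longrightarrow> Ck k g \<Longrightarrow> Ck k (\<lambda>z. f z * g z)"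
proof (induction k arbitrary: f g)
  case 0
  then show ?case by (auto intro: continuous_on_mult)
next
  case (Suc k)
  obtain f' where f': "\<And>z. (f has_derivative f' z) (at z)" "\<And>v. Ck k (\<lambda>z. f' z v)"
    using Suc.prems(1) by (metis Ck.simps(2))
  obtain g' where g': "\<And>z. (g has_derivative g' z) (at z)" "\<And>v. Ck k (\<lambda>z. g' z v)"
    using Suc.prems(2) by (metis Ck.simps(2))
  have "Ck k f" "Ck k g" using Suc.prems by (blast intro: Ck_Suc_imp)+
  then have "Ck k (\<lambda>z. f z * g' z v + f' z v * g z)" for v
    using f' g' Suc.IH Ck_add by auto
  then show ?case
    using f' g'
    by (auto intro!: exI[of _ "\<lambda>z v. f z * g' z v + f' z v * g z"] has_derivative_mult)
qed

text \<open>The velocity field agrees with a finite stage only near each point, and the stage varies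
  with the point. The derivative at z is read off from the function chosen for z; uniqueness of
  derivatives makes these choices agree on overlaps.\<close>

lemma Ck_local:
  assumes "\<And>z. \<exists>S h. open S \<and> z \<in> S \<and> Ck k h \<and> (\<forall>w\<in>S. f w = h w)"
  shows "Ck k f"
  using assms
proof (induction k arbitrary: f)
  case 0
  have "continuous (at z) f" for z
  proof -
    obtain S h where S: "open S" "z \<in> S" "continuous_on UNIV h" "\<forall>w\<in>S. f w = h w"
      using 0 by (metis Ck.simps(1))
    then have "continuous_on S f"
      by (metis continuous_on_cong continuous_on_subset top_greatest)
    then show ?thesis using S(1,2) continuous_on_eq_continuous_at by blast
  qed
  then show ?case by (simp add: continuous_on_eq_continuous_at)
next
  case (Suc k)
  obtain S h where S: "\<And>z. open (S z)" "\<And>z. z \<in> S z" "\<And>z. Ck (Suc k) (h z)"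
      "\<And>z w. w \<in> S z \<Longrightarrow> f w = h z w"
    using Suc.prems by metis
  obtain h' where h': "\<And>z w. (h z has_derivative h' z w) (at w)" "\<And>z v. Ck k (\<lambda>w. h' z w v)"
  proof -
    have "\<exists>h'. (\<forall>w. (h z has_derivative h' w) (at w)) \<and> (\<forall>v. Ck k (\<lambda>w. h' w v))" for z
      using S(3)[of z] by (simp only: Ck.simps(2))
    then show thesis using that by metis
  qed
  have f': "(f has_derivative h' z w) (at w)" if "w \<in> S z" for z w
    using h'(1)[of z w] S(1,4) that has_derivative_transform_within_open
    by (smt (verit, best))
  have "Ck k (\<lambda>w. h' w w v)" for v
  proof (rule Suc.IH)
    fix z
    have "h' w w = h' z w" if "w \<in> S z" for w
      using f' that S(2) has_derivative_unique by metis
    then show "\<exists>S h. open S \<and> z \<in> S \<and> Ck k h \<and> (\<forall>w\<in>S. h' w w v = h w)"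
      using S(1,2) h'(2) by (metis (no_types, lifting))
  qed
  then show ?case using f' S(2) by (auto intro!: exI[of _ "\<lambda>z. h' z z"])
qed

fun Ck_real :: "nat \<Rightarrow> (real \<Rightarrow> real) \<Rightarrow> bool" where
  "Ck_real 0 f = continuous_on UNIV f"
| "Ck_real (Suc k) f = (\<exists>f'. (\<forall>x. (f has_real_derivative f' x) (at x)) \<and> Ck_real k f')"

lemma Ck_real_Suc_imp: "Ck_real (Suc k) f \<Longrightarrow> Ck_real k f"
proof (induction k arbitrary: f)
  case 0
  then show ?case
    by (auto simp: continuous_on_eq_continuous_at intro: DERIV_isCont)
next
  case (Suc k)
  then show ?case by (metis Ck_real.simps(2))
qed

lemma Ck_real_const: "Ck_real k (\<lambda>z. c)"
  by (induction k arbitrary: c) (auto intro!: exI[of _ "\<lambda>z. 0"])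

lemma Ck_real_add: "Ck_real k f \<Longrightarrow> Ck_real k g \<Longrightarrow> Ck_real k (\<lambda>x. f x + g x)"
proof (induction k arbitrary: f g)
  case 0
  then show ?case by (auto intro: continuous_on_add)
next
  case (Suc k)
  obtain f' where f': "\<And>z. (f has_real_derivative f' z) (at z)" "Ck_real k f'"
    using Suc.prems(1) by auto
  obtain g' where g': "\<And>z. (g has_real_derivative g' z) (at z)" "Ck_real k g'"
    using Suc.prems(2) by auto
  show ?case
    using f' g' Suc.IH by (auto intro!: exI[of _ "\<lambda>x. f' x + g' x"] DERIV_add)
qed

lemma Ck_real_mult: "Ck_real k f \<Longrightarrow> Ck_real k g \<Longrightarrow> Ck_real k (\<lambda>x. f x * g x)"
proof (induction k arbitrary: f g)
  case 0
  then show ?case by (auto intro: continuous_on_mult)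
next
  case (Suc k)
  obtain f' where f': "\<And>z. (f has_real_derivative f' z) (at z)" "Ck_real k f'"
    using Suc.prems(1) by auto
  obtain g' where g': "\<And>z. (g has_real_derivative g' z) (at z)" "Ck_real k g'"
    using Suc.prems(2) by auto
  have "Ck_real k f" "Ck_real k g" using Suc.prems by (blast intro: Ck_real_Suc_imp)+
  then have "Ck_real k (\<lambda>x. f' x * g x + g' x * f x)"
    using f' g' Suc.IH Ck_real_add by auto
  then show ?case
    using f' g' by (auto intro!: exI[of _ "\<lambda>x. f' x * g x + g' x * f x"] DERIV_mult)
qed

lemma Ck_real_affine: "Ck_real k f \<Longrightarrow> Ck_real k (\<lambda>x. f (a + c * x))"
proof (induction k arbitrary: f)
  case 0
  then show ?case
    by (auto intro!: continuous_intros continuous_on_compose2[of UNIV f])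
next
  case (Suc k)
  obtain f' where f': "\<And>z. (f has_real_derivative f' z) (at z)" "Ck_real k f'"
    using Suc.prems(1) by auto
  have "((\<lambda>x. f (a + c * x)) has_real_derivative f' (a + c * x) * c) (at x)" for x
    by (rule DERIV_chain2[OF f'(1)]) (auto intro!: derivative_eq_intros)
  moreover have "Ck_real k (\<lambda>x. f' (a + c * x) * c)"
    using Suc.IH f'(2) Ck_real_const Ck_real_mult by auto
  ultimately show ?case by (auto intro!: exI[of _ "\<lambda>x. f' (a + c * x) * c"])
qed

text \<open>Each bump of the field depends on z through one linear form only, so its smoothness
  reduces to one variable.\<close>

lemma Ck_compose_linear:
  assumes l: "bounded_linear l"
  shows "Ck_real k f \<Longrightarrow> Ck k (\<lambda>z. f (l z))"
proof (induction k arbitrary: f)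
  case 0
  then show ?case
    using continuous_on_compose2[of UNIV f UNIV l] linear_continuous_on[OF l] by simp
next
  case (Suc k)
  obtain f' where f': "\<And>z. (f has_real_derivative f' z) (at z)" "Ck_real k f'"
    using Suc.prems(1) by auto
  have "((\<lambda>z. f (l z)) has_derivative (\<lambda>v. f' (l z) * l v)) (at z)" for z
  proof -
    have "(f has_derivative (\<lambda>y. f' (l z) * y)) (at (l z))"
      using f'(1)[of "l z"] by (simp add: has_field_derivative_def)
    from has_derivative_compose[OF bounded_linear_imp_has_derivative[OF l] this]
    show ?thesis .
  qed
  moreover have "Ck k (\<lambda>z. f' (l z) * l v)" for v
    using Suc.IH f'(2) Ck_const Ck_mult by auto
  ultimately show ?case by (auto intro!: exI[of _ "\<lambda>z v. f' (l z) * l v"])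
qed

text \<open>The classical flat function exp(-1/x); the polynomial factors in 1/x make the family
  closed under differentiation.\<close>

definition flat_exp :: "real poly \<Rightarrow> real \<Rightarrow> real" where
  "flat_exp p x = (if x > 0 then poly p (1 / x) * exp (- (1 / x)) else 0)"

lemma tendsto_poly_times_exp_minus:
  "((\<lambda>y::real. poly p y * exp (- y)) \<longlongrightarrow> 0) at_top"
proof -
  \<comment> \<open>The extra power of y is a generalization for the induction: the factor y
    contributed by \<open>pCons\<close> moves into the exponent k.\<close>
  have "((\<lambda>y::real. y ^ k * (poly p y * exp (- y))) \<longlongrightarrow> 0) at_top" for k
  proof (induction p arbitrary: k)
    case 0
    then show ?case by simp
  next
    case (pCons a p)
    have "((\<lambda>y::real. a * (y ^ k / exp y) + y ^ Suc k * (poly p y * exp (- y))) \<longlongrightarrow> a * 0 + 0) at_top"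
      by (intro tendsto_intros tendsto_power_div_exp_0 pCons.IH)
    then show ?case by (simp add: algebra_simps exp_minus divide_inverse)
  qed
  from this[of 0] show ?thesis by simp
qed

text \<open>With y = 1/x the chain rule contributes -y^2 and turns p(y) exp(-y) into y^2 (p - p')(y)
  exp(-y). At the origin the exponential beats every power of 1/h.\<close>

lemma flat_exp_has_derivative:
  "(flat_exp p has_real_derivative flat_exp ([:0, 0, 1:] * (p - pderiv p)) x) (at x)"
proof -
  consider "x > 0" | "x < 0" | "x = 0" by linarith
  then show ?thesis
  proof cases
    case 1
    have "((\<lambda>x. poly p (1 / x) * exp (- (1 / x))) has_real_derivative
        flat_exp ([:0, 0, 1:] * (p - pderiv p)) x) (at x)"
      using 1
      by (auto intro!: derivative_eq_intros DERIV_chain2[OF poly_DERIV]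
            simp: flat_exp_def field_simps power2_eq_square)
    then show ?thesis
      by (rule has_field_derivative_transform_within_open[where S = "{0<..}"])
        (use 1 in \<open>auto simp: flat_exp_def\<close>)
  next
    case 2
    have "((\<lambda>x. 0) has_real_derivative flat_exp ([:0, 0, 1:] * (p - pderiv p)) x) (at x)"
      using 2 by (auto simp: flat_exp_def)
    then show ?thesis
      by (rule has_field_derivative_transform_within_open[where S = "{..<0}"])
        (use 2 in \<open>auto simp: flat_exp_def\<close>)
  next
    case 3
    \<comment> \<open>Dividing by h multiplies the polynomial by 1/h, hence
      \<open>pCons 0 p\<close>.\<close>
    have "((\<lambda>h. poly (pCons 0 p) (inverse h) * exp (- (inverse h))) \<longlongrightarrow> 0) (at_right 0)"
      by (rule filterlim_compose[OF tendsto_poly_times_exp_minus filterlim_inverse_at_top_right])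
    then have "((\<lambda>h. flat_exp p h / h) \<longlongrightarrow> 0) (at_right 0)"
      by (rule tendsto_cong[THEN iffD1, rotated])
        (auto simp: flat_exp_def eventually_at_filter divide_inverse algebra_simps)
    moreover have "((\<lambda>h. flat_exp p h / h) \<longlongrightarrow> 0) (at_left 0)"
      by (rule tendsto_cong[THEN iffD1, OF _ tendsto_const])
        (auto simp: flat_exp_def eventually_at_filter)
    ultimately have "((\<lambda>h. flat_exp p h / h) \<longlongrightarrow> 0) (at 0)"
      by (simp add: filterlim_split_at)
    then show ?thesis
      using 3 by (simp add: has_field_derivative_iff flat_exp_def)
  qed
qed

lemma Ck_real_flat_exp: "Ck_real k (flat_exp p)"
proof (induction k arbitrary: p)
  case 0
  have "isCont (flat_exp p) x" for x using flat_exp_has_derivative DERIV_isCont by blast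
  then show ?case by (simp add: continuous_on_eq_continuous_at)
next
  case (Suc k)
  then show ?case using flat_exp_has_derivative by (metis Ck_real.simps(2))
qed

section \<open>Compactly supported kernels and mollified indicators of Borel sets\<close>

lemma integrable_compact_support:
  fixes f :: "real \<Rightarrow> real"
  assumes "continuous_on UNIV f" "\<And>x. \<bar>x\<bar> > 1 \<Longrightarrow> f x = 0"
  shows "integrable lborel f"
proof -
  have "continuous_on {-1..1} f" using assms(1) by (rule continuous_on_subset) simp
  then have "set_integrable lborel {-1..1} f"
    unfolding set_integrable_def by (intro borel_integrable_compact) auto
  moreover have "(\<lambda>x. indicator {-1..1} x *\<^sub>R f x) = f"
    using assms(2) by (force simp: fun_eq_iff indicator_def)
  ultimately show ?thesis by (simp add: set_integrable_def)
qed

lemma mollifier_exists: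
  "\<exists>\<rho>. (\<forall>k. Ck_real k \<rho>) \<and> (\<forall>x. \<rho> x \<ge> 0) \<and> (\<forall>x. \<bar>x\<bar> > 1 \<longrightarrow> \<rho> x = 0) \<and>
       integral\<^sup>L lborel \<rho> = 1"
proof -
  \<comment> \<open>The first factor vanishes for x \<le> -1 and the second for x \<ge> 1, so the
    product is positive exactly on (-1, 1).\<close>
  define \<psi> where "\<psi> x = flat_exp 1 (1 + 1 * x) * flat_exp 1 (1 + (- 1) * x)" for x
  have C: "Ck_real k \<psi>" for k
    unfolding \<psi>_def by (intro Ck_real_mult Ck_real_affine Ck_real_flat_exp)
  have cont: "continuous_on UNIV \<psi>" using C[of 0] by simp
  have nn: "\<psi> x \<ge> 0" for x by (simp add: \<psi>_def flat_exp_def)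
  have supp: "\<psi> x = 0" if "\<bar>x\<bar> > 1" for x using that by (auto simp: \<psi>_def flat_exp_def)
  have int: "integrable lborel \<psi>" by (rule integrable_compact_support[OF cont supp])
  have "integral\<^sup>L lborel \<psi> \<noteq> 0"
  proof
    assume "integral\<^sup>L lborel \<psi> = 0"
    then have "AE x in lborel. \<psi> x = 0"
      using integral_nonneg_eq_0_iff_AE[OF int] nn by auto
    then have "AE x in lborel. x \<notin> {-1<..<1::real}"
      by (rule AE_mp) (rule AE_I2, auto simp: \<psi>_def flat_exp_def split: if_splits)
    then have "{-1<..<1::real} \<in> null_sets lborel" by (subst AE_iff_null_sets) auto
    then show False by (auto simp: null_sets_def)
  qed
  then have pos: "integral\<^sup>L lborel \<psi> > 0" using Bochner_Integration.integral_nonneg[of lborel \<psi>] nn by (simp add: less_le)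
  define \<rho> where "\<rho> x = \<psi> x * (1 / integral\<^sup>L lborel \<psi>)" for x
  have "Ck_real k \<rho>" for k unfolding \<rho>_def by (intro Ck_real_mult C Ck_real_const)
  moreover have "integral\<^sup>L lborel \<rho> = 1" unfolding \<rho>_def using pos int by simp
  ultimately show ?thesis using nn supp pos by (intro exI[of _ \<rho>]) (auto simp: \<rho>_def)
qed

lemma integrable_mult_set:
  fixes f :: "real \<Rightarrow> real"
  assumes "continuous_on UNIV f" "\<And>x. \<bar>x\<bar> > 1 \<Longrightarrow> f x = 0" "C \<in> sets borel"
  shows "integrable lborel (\<lambda>r. f (r - s) * indicator C r)"
proof (rule Bochner_Integration.integrable_bound)
  show "integrable lborel (\<lambda>r. f (r - s))"
    using lborel_integrable_real_affine[OF integrable_compact_support[OF assms(1,2)], of 1 "- s"] by simp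
  have [measurable]: "f \<in> borel_measurable borel"
    using assms(1) by (rule borel_measurable_continuous_onI)
  note assms(3)[measurable]
  show "(\<lambda>r. f (r - s) * indicator C r) \<in> borel_measurable lborel" by measurable
qed (auto simp: indicator_def)

text \<open>The derivative falls on the kernel, so the Borel set C may be arbitrarily rough.
  Dominated convergence applies because the difference quotients are bounded by the supremum of
  |f'|.\<close>

lemma convolution_has_derivative:
  fixes f :: "real \<Rightarrow> real"
  assumes d: "\<And>x. (f has_real_derivative f' x) (at x)" and c: "continuous_on UNIV f'"
    and s: "\<And>x. \<bar>x\<bar> > 1 \<Longrightarrow> f x = 0" and s': "\<And>x. \<bar>x\<bar> > 1 \<Longrightarrow> f' x = 0" and C: "C \<in> sets borel"
  shows "((\<lambda>s. LINT r|lborel. f (r - s) * indicator C r) has_real_derivative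
           - (LINT r|lborel. f' (r - s) * indicator C r)) (at s)"
proof -
  have cf: "continuous_on UNIV f"
    using d DERIV_isCont by (auto simp: continuous_on_eq_continuous_at)
  have [measurable]: "f \<in> borel_measurable borel" "f' \<in> borel_measurable borel"
    using c cf by (auto intro: borel_measurable_continuous_onI)
  note C[measurable]
  obtain K where K: "\<And>x. \<bar>f' x\<bar> \<le> K"
  proof -
    have "bounded (f' ` {-1..1})"
      by (meson c compact_Icc compact_continuous_image compact_imp_bounded continuous_on_subset top_greatest)
    then obtain K where K: "\<And>x. x \<in> {-1..1} \<Longrightarrow> \<bar>f' x\<bar> \<le> K"
      unfolding bounded_iff by (metis image_eqI real_norm_def)
    have "\<bar>f' x\<bar> \<le> K" for x
    proof (cases "\<bar>x\<bar> \<le> 1")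
      case False
      then show ?thesis using s'[of x] K[of 0] by auto
    qed (auto intro!: K)
    then show thesis using that by blast
  qed
  have lip: "\<bar>f x - f y\<bar> \<le> K * \<bar>x - y\<bar>" for x y
    using field_differentiable_bound[of UNIV f f' K] d K by (auto simp: has_field_derivative_at_within)
  define q where "q h r = (f (r - (s + h)) - f (r - s)) / h * indicator C r" for h r
  have "((\<lambda>h. LINT r|lborel. q h r) \<longlongrightarrow> (LINT r|lborel. - f' (r - s) * indicator C r)) (at 0)"
    unfolding tendsto_at_iff_sequentially
  proof (intro allI impI)
    fix X :: "nat \<Rightarrow> real" assume X0: "\<forall>i. X i \<in> UNIV - {0}" and X: "X \<longlonglongrightarrow> 0"
    \<comment> \<open>Once |h| < 1, both translates of f are supported within distance 2 of s; this
      gives the integrable majorant on {s-2..s+2}.\<close>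
    obtain N where N: "\<And>n. n \<ge> N \<Longrightarrow> \<bar>X n\<bar> < 1"
      using X[unfolded LIMSEQ_def, rule_format, of 1] by auto
    have "(\<lambda>n. LINT r|lborel. q (X (n + N)) r) \<longlonglongrightarrow> (LINT r|lborel. - f' (r - s) * indicator C r)"
    proof (rule integral_dominated_convergence[where w = "\<lambda>r. K * indicator {s-2..s+2} r"])
      show "integrable lborel (\<lambda>r. K * indicator {s-2..s+2} r)"
        by (intro integrable_mult_right) (simp add: integrable_indicator_iff)
      show "AE r in lborel. (\<lambda>n. q (X (n + N)) r) \<longlonglongrightarrow> - f' (r - s) * indicator C r"
      proof (rule AE_I2)
        fix r
        have "((\<lambda>h. f (r - h)) has_real_derivative f' (r - s) * (- 1)) (at s)"
          by (rule DERIV_chain2[OF d]) (auto intro!: derivative_eq_intros)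
        then have "((\<lambda>h. (f (r - (s + h)) - f (r - s)) / h) \<longlongrightarrow> - f' (r - s)) (at 0)"
          by (simp add: DERIV_def)
        moreover have "filterlim (\<lambda>n. X (n + N)) (at 0) sequentially"
          unfolding filterlim_at using X0 LIMSEQ_ignore_initial_segment[OF X] by simp
        ultimately have "(\<lambda>n. (f (r - (s + X (n + N))) - f (r - s)) / X (n + N)) \<longlonglongrightarrow> - f' (r - s)"
          by (rule filterlim_compose)
        then show "(\<lambda>n. q (X (n + N)) r) \<longlonglongrightarrow> - f' (r - s) * indicator C r"
          unfolding q_def by (intro tendsto_intros)
      qed
      show "AE r in lborel. norm (q (X (n + N)) r) \<le> K * indicator {s-2..s+2} r" for n
      proof (rule AE_I2)
        fix r
        have x: "\<bar>X (n + N)\<bar> < 1" "X (n + N) \<noteq> 0" using N X0 by auto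
        show "norm (q (X (n + N)) r) \<le> K * indicator {s-2..s+2} r"
        proof (cases "r \<in> {s-2..s+2}")
          case True
          have "\<bar>(f (r - (s + X (n + N))) - f (r - s)) / X (n + N)\<bar> \<le> K"
            using lip[of "r - (s + X (n + N))" "r - s"] x by (simp add: field_simps)
          then show ?thesis using True K[of 0] unfolding q_def indicator_def abs_mult by auto
        next
          case False
          have "\<bar>r - s\<bar> > 1" "\<bar>r - (s + X (n + N))\<bar> > 1" using False x by (auto simp: abs_if split: if_splits)
          then show ?thesis using s False by (simp add: q_def)
        qed
      qed
    qed (auto simp: q_def)
    then have "(\<lambda>n. LINT r|lborel. q (X n) r) \<longlonglongrightarrow> (LINT r|lborel. - f' (r - s) * indicator C r)"
      by (rule LIMSEQ_offset)
    then show "((\<lambda>h. LINT r|lborel. q h r) \<circ> X) \<longlonglongrightarrow> (LINT r|lborel. - f' (r - s) * indicator C r)"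
      by (simp add: o_def)
  qed
  moreover have "(LINT r|lborel. q h r) =
      ((LINT r|lborel. f (r - (s + h)) * indicator C r) - (LINT r|lborel. f (r - s) * indicator C r)) / h" for h
  proof -
    have "(LINT r|lborel. q h r) =
       (LINT r|lborel. (f (r - (s + h)) * indicator C r - f (r - s) * indicator C r) / h)"
      unfolding q_def by (intro Bochner_Integration.integral_cong) (auto simp: algebra_simps)
    also have "\<dots> = (LINT r|lborel. f (r - (s + h)) * indicator C r - f (r - s) * indicator C r) / h"
      by simp
    also have "\<dots> = ((LINT r|lborel. f (r - (s + h)) * indicator C r) - (LINT r|lborel. f (r - s) * indicator C r)) / h"
      using integrable_mult_set[OF cf s C] by (subst Bochner_Integration.integral_diff) auto
    finally show ?thesis .
  qed
  ultimately show ?thesis by (simp add: DERIV_def)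
qed

lemma derivative_support:
  assumes d: "\<And>x. (f has_real_derivative f' x) (at x)" and s: "\<And>x::real. \<bar>x\<bar> > 1 \<Longrightarrow> f x = 0"
    and x: "\<bar>x\<bar> > 1"
  shows "f' x = 0"
proof -
  have "open {x::real. 1 < \<bar>x\<bar>}" by (intro open_Collect_less continuous_intros)
  then have "(f has_real_derivative 0) (at x)"
    using x s by (intro has_field_derivative_transform_within_open[OF DERIV_const[of 0]]) auto
  then show ?thesis using d DERIV_unique by blast
qed

text \<open>The induction runs over kernels: the derivative is minus the convolution with f', and f'
  is again smooth with the same support bound.\<close>

lemma Ck_real_convolution:
  assumes C: "C \<in> sets borel"
  shows "(\<And>k. Ck_real k f) \<Longrightarrow> (\<And>x. \<bar>x\<bar> > 1 \<Longrightarrow> f x = 0) \<Longrightarrow>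
     Ck_real k (\<lambda>s. LINT r|lborel. f (r - s) * indicator C r)"
proof (induction k arbitrary: f)
  case 0
  obtain f' where d: "\<And>x. (f has_real_derivative f' x) (at x)" and c: "continuous_on UNIV f'"
    using 0(1)[of 1] by auto
  have "isCont (\<lambda>s. LINT r|lborel. f (r - s) * indicator C r) s" for s
    using convolution_has_derivative[OF d c 0(2) derivative_support[OF d 0(2)] C] DERIV_isCont
    by blast
  then show ?case by (simp add: continuous_on_eq_continuous_at)
next
  case (Suc k)
  obtain f' where d: "\<And>x. (f has_real_derivative f' x) (at x)"
    using Suc(2)[of 1] by auto
  have C': "Ck_real j f'" for j
  proof -
    obtain g where "\<And>x. (f has_real_derivative g x) (at x)" "Ck_real j g"
      using Suc(2)[of "Suc j"] by auto
    then show ?thesis using d DERIV_unique by (metis ext)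
  qed
  have s': "f' x = 0" if "\<bar>x\<bar> > 1" for x using derivative_support[OF d Suc(3) that] .
  have "Ck_real k (\<lambda>s. LINT r|lborel. f' (r - s) * indicator C r)"
    using Suc.IH[OF C' s'] .
  then have "Ck_real k (\<lambda>s. - 1 * (LINT r|lborel. f' (r - s) * indicator C r))"
    by (intro Ck_real_mult Ck_real_const)
  moreover have "((\<lambda>s. LINT r|lborel. f (r - s) * indicator C r) has_real_derivative
           - 1 * (LINT r|lborel. f' (r - s) * indicator C r)) (at s)" for s
    using convolution_has_derivative[OF d _ Suc(3) s' C] C'[of 0] by simp
  ultimately show ?case unfolding Ck_real.simps(2)
    by (intro exI[of _ "\<lambda>s. - 1 * (LINT r|lborel. f' (r - s) * indicator C r)"]) simp
qed

section \<open>Global solutions of scalar equations\<close>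

text \<open>Boundedness of f confines all Picard iterates to one cone, so on each compact time
  interval a single Lipschitz constant serves every iterate and no gluing of local solutions is
  needed.\<close>

lemma picard_global:
  fixes f :: "real \<times> real \<Rightarrow> real"
  assumes cont: "continuous_on UNIV f" and bd: "\<And>z. \<bar>f z\<bar> \<le> K"
    and lip: "\<And>R. \<exists>C. \<forall>t x y. \<bar>t\<bar> \<le> R \<longrightarrow> \<bar>x\<bar> \<le> R \<longrightarrow> \<bar>y\<bar> \<le> R \<longrightarrow> \<bar>f (t, x) - f (t, y)\<bar> \<le> C * \<bar>x - y\<bar>"
  shows "\<exists>x. is_solution f t0 x0 x"
proof -
  have K: "K \<ge> 0" using bd[of 0] by linarith
  define X where "X = rec_nat (\<lambda>t. x0) (\<lambda>n g t. x0 + integral {t0..t} (\<lambda>s. f (s, g s)))"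
  have X0: "X 0 t = x0" and XS: "X (Suc n) t = x0 + integral {t0..t} (\<lambda>s. f (s, X n s))" for n t
    by (auto simp: X_def)
  have fint: "(\<lambda>s. f (s, g s)) integrable_on {a..b}" "continuous_on {a..b} (\<lambda>s. f (s, g s))"
    if "continuous_on {a..b} g" for g a b
  proof -
    show "continuous_on {a..b} (\<lambda>s. f (s, g s))"
      using that by (intro continuous_on_compose2[OF cont] continuous_intros) auto
    then show "(\<lambda>s. f (s, g s)) integrable_on {a..b}" by (rule integrable_continuous_interval)
  qed
  have fb: "\<bar>integral {a..b} (\<lambda>s. f (s, g s))\<bar> \<le> K * (b - a)" if "continuous_on {a..b} g" "a \<le> b" for g a b
    using integral_bound[OF that(2) fint(2)[OF that(1)], of K] bd by auto
  have Xc: "continuous_on {t0..T} (X n)" and Xl: "\<And>s t. t0 \<le> s \<Longrightarrow> s \<le> t \<Longrightarrow> t \<le> T \<Longrightarrow> \<bar>X n t - X n s\<bar> \<le> K * (t - s)" for n T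
  proof -
    have "continuous_on {t0..T} (X n) \<and> (\<forall>s t. t0 \<le> s \<longrightarrow> s \<le> t \<longrightarrow> t \<le> T \<longrightarrow> \<bar>X n t - X n s\<bar> \<le> K * (t - s))"
    proof (induction n)
      case 0
      have "X 0 = (\<lambda>t. x0)" using X0 by auto
      then show ?case using K by auto
    next
      case (Suc n)
      have c: "continuous_on {t0..T} (X n)" using Suc by blast
      have "continuous_on {t0..T} (\<lambda>t. x0 + integral {t0..t} (\<lambda>s. f (s, X n s)))"
        by (intro continuous_intros indefinite_integral_continuous_1 fint c)
      moreover have "X (Suc n) = (\<lambda>t. x0 + integral {t0..t} (\<lambda>s. f (s, X n s)))" using XS by auto
      moreover have "\<bar>X (Suc n) t - X (Suc n) s\<bar> \<le> K * (t - s)" if st: "t0 \<le> s" "s \<le> t" "t \<le> T" for s t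
      proof -
        have "continuous_on {t0..t} (X n)" using c st continuous_on_subset by fastforce
        then have "integral {t0..s} (\<lambda>s. f (s, X n s)) + integral {s..t} (\<lambda>s. f (s, X n s)) = integral {t0..t} (\<lambda>s. f (s, X n s))"
          using st by (intro Henstock_Kurzweil_Integration.integral_combine fint) auto
        then have "X (Suc n) t - X (Suc n) s = integral {s..t} (\<lambda>s. f (s, X n s))"
          by (simp add: XS)
        moreover have "continuous_on {s..t} (X n)" using c st by (auto intro: continuous_on_subset)
        ultimately show ?thesis using fb[of s t "X n"] st by simp
      qed
      ultimately show ?case by simp
    qed
    then show "continuous_on {t0..T} (X n)" "\<And>s t. t0 \<le> s \<Longrightarrow> s \<le> t \<Longrightarrow> t \<le> T \<Longrightarrow> \<bar>X n t - X n s\<bar> \<le> K * (t - s)"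
      by auto
  qed
  have Xt0: "X n t0 = x0" for n by (cases n) (auto simp: X0 XS)
  have conv: "convergent (\<lambda>n. X n t)" if "t0 \<le> t" for t
  proof -
    \<comment> \<open>Chosen to bound both the times in [t0, t] and the values of all iterates
      there.\<close>
    define R where "R = \<bar>t0\<bar> + \<bar>t\<bar> + \<bar>x0\<bar> + K * (t - t0)"
    obtain C0 where C0: "\<And>s x y. \<bar>s\<bar> \<le> R \<Longrightarrow> \<bar>x\<bar> \<le> R \<Longrightarrow> \<bar>y\<bar> \<le> R \<Longrightarrow> \<bar>f (s, x) - f (s, y)\<bar> \<le> C0 * \<bar>x - y\<bar>"
      using lip[of R] by blast
    define C where "C = max C0 1"
    have C: "C \<ge> 1" by (simp add: C_def)
    have CL: "\<bar>f (s, x) - f (s, y)\<bar> \<le> C * \<bar>x - y\<bar>" if "\<bar>s\<bar> \<le> R" "\<bar>x\<bar> \<le> R" "\<bar>y\<bar> \<le> R" for s x y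
      using C0[OF that] mult_right_mono[of C0 C "\<bar>x - y\<bar>"] by (simp add: C_def)
    have KR: "\<bar>X n s\<bar> \<le> R" "\<bar>s\<bar> \<le> R" if "s \<in> {t0..t}" for n s
    proof -
      have "\<bar>X n s - X n t0\<bar> \<le> K * (s - t0)" using Xl[of t0 s t n] that by auto
      also have "\<dots> \<le> K * (t - t0)" using that K by (intro mult_left_mono) auto
      finally show "\<bar>X n s\<bar> \<le> R" unfolding R_def using Xt0[of n] by linarith
      have "0 \<le> K * (t - t0)" using that K by auto
      then show "\<bar>s\<bar> \<le> R" using that unfolding R_def by auto
    qed
    define A where "A = K * (t - t0)"
    have A: "A \<ge> 0" using K \<open>t0 \<le> t\<close> by (simp add: A_def)
    \<comment> \<open>The weight exp(2C(s - t0)) makes the integral operator contract by 1/2 however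
      long the interval is: integrating C times the weight gives at most half the weight.\<close>
    have est: "\<bar>X (Suc n) s - X n s\<bar> \<le> A * (1 / 2) ^ n * exp (2 * C * (s - t0))" if "s \<in> {t0..t}" for n s
      using that
    proof (induction n arbitrary: s)
      case 0
      have "\<bar>X (Suc 0) s - X 0 s\<bar> \<le> K * (s - t0)"
        using Xl[of t0 s t "Suc 0"] Xt0[of "Suc 0"] 0 by (auto simp: X0)
      also have "\<dots> \<le> A * 1" unfolding A_def using 0 K by (auto intro!: mult_left_mono)
      also have "\<dots> \<le> A * exp (2 * C * (s - t0))" using 0 C A by (intro mult_left_mono) auto
      finally show ?case by simp
    next
      case (Suc n)
      have c: "continuous_on {t0..s} (X n)" "continuous_on {t0..s} (X (Suc n))" using Xc by auto
      let ?g = "\<lambda>r. C * (A * (1 / 2) ^ n * exp (2 * C * (r - t0)))"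
      let ?G = "\<lambda>r. A * (1 / 2) ^ Suc n * exp (2 * C * (r - t0))"
      have G: "(?g has_integral ?G s - ?G t0) {t0..s}"
        using Suc.prems
        by (intro fundamental_theorem_of_calculus)
          (auto intro!: derivative_eq_intros simp: has_real_derivative_iff_has_vector_derivative[symmetric])
      have "X (Suc (Suc n)) s - X (Suc n) s = integral {t0..s} (\<lambda>r. f (r, X (Suc n) r) - f (r, X n r))"
        unfolding XS[of "Suc n"] XS[of n s]
        by (subst Henstock_Kurzweil_Integration.integral_diff) (use fint c in auto)
      also have "norm \<dots> \<le> integral {t0..s} ?g"
      proof (rule integral_norm_bound_integral)
        show "(\<lambda>r. f (r, X (Suc n) r) - f (r, X n r)) integrable_on {t0..s}"
          by (intro Henstock_Kurzweil_Integration.integrable_diff fint c)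
        show "?g integrable_on {t0..s}" using G by blast
        fix r assume r: "r \<in> {t0..s}"
        then have r': "r \<in> {t0..t}" using Suc.prems by auto
        have "norm (f (r, X (Suc n) r) - f (r, X n r)) \<le> C * \<bar>X (Suc n) r - X n r\<bar>"
          using CL KR[OF r'] by simp
        also have "\<dots> \<le> ?g r" using Suc.IH[OF r'] C by (intro mult_left_mono) auto
        finally show "norm (f (r, X (Suc n) r) - f (r, X n r)) \<le> ?g r" .
      qed
      also have "\<dots> = ?G s - ?G t0" using G by (rule integral_unique)
      also have "\<dots> \<le> ?G s" using A by simp
      finally show ?case by simp
    qed
    have "summable (\<lambda>n. A * (1 / 2) ^ n * exp (2 * C * (t - t0)))"
      by (intro summable_mult2 summable_mult summable_geometric) simp
    then have "summable (\<lambda>n. X (Suc n) t - X n t)"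
      by (rule summable_comparison_test'[of _ 0]) (use est[of t] that in auto)
    then have "convergent (\<lambda>n. \<Sum>k<n. X (Suc k) t - X k t)" by (simp add: summable_iff_convergent)
    moreover have "(\<Sum>k<n. X (Suc k) t - X k t) = X n t - x0" for n
      using sum_lessThan_telescope[of "\<lambda>k. X k t" n] by (simp add: X0)
    ultimately have "convergent (\<lambda>n. X n t - x0)" by simp
    from convergent_add[OF this convergent_const[of x0]] show ?thesis by simp
  qed
  define x where "x t = lim (\<lambda>n. X n t)" for t
  have lim: "(\<lambda>n. X n t) \<longlonglongrightarrow> x t" if "t0 \<le> t" for t
    using conv[OF that] by (simp add: x_def convergent_LIMSEQ_iff)
  have xl: "\<bar>x t - x s\<bar> \<le> K * \<bar>t - s\<bar>" if "t0 \<le> s" "t0 \<le> t" for s t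
  proof -
    have "\<bar>X n t - X n s\<bar> \<le> K * \<bar>t - s\<bar>" for n
      using Xl[of s t t n] Xl[of t s s n] that by (cases "s \<le> t") (auto simp: abs_minus_commute)
    moreover have "(\<lambda>n. \<bar>X n t - X n s\<bar>) \<longlonglongrightarrow> \<bar>x t - x s\<bar>" using that by (intro tendsto_intros lim)
    ultimately show ?thesis by (intro LIMSEQ_le_const2) auto
  qed
  have xc: "continuous_on {t0..T} x" for T
  proof -
    have "K-lipschitz_on {t0..T} x"
      using xl K by (intro lipschitz_onI) (auto simp: dist_real_def)
    then show ?thesis by (rule lipschitz_on_continuous_on)
  qed
  have eq: "x t = x0 + integral {t0..t} (\<lambda>s. f (s, x s))" if "t0 \<le> t" for t
  proof -
    have "(\<lambda>n. integral {t0..t} (\<lambda>s. f (s, X n s))) \<longlonglongrightarrow> integral {t0..t} (\<lambda>s. f (s, x s))"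
    proof (rule dominated_convergence(2)[where h = "\<lambda>_. K"])
      fix n show "(\<lambda>s. f (s, X n s)) integrable_on {t0..t}" by (intro fint Xc)
    next
      fix s assume "s \<in> {t0..t}"
      then have "(\<lambda>n. (s, X n s)) \<longlonglongrightarrow> (s, x s)" by (intro tendsto_intros lim) auto
      then show "(\<lambda>n. f (s, X n s)) \<longlonglongrightarrow> f (s, x s)"
        using cont by (auto simp: continuous_on_eq_continuous_at intro: isCont_tendsto_compose)
    qed (use bd in auto)
    then have "(\<lambda>n. X (Suc n) t) \<longlonglongrightarrow> x0 + integral {t0..t} (\<lambda>s. f (s, x s))"
      unfolding XS by (intro tendsto_intros)
    moreover have "(\<lambda>n. X (Suc n) t) \<longlonglongrightarrow> x t" using lim[OF that] by (rule LIMSEQ_Suc)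
    ultimately show ?thesis using LIMSEQ_unique by blast
  qed
  have "(x has_real_derivative f (t, x t)) (at t within {t0..})" if t: "t \<ge> t0" for t
  proof -
    have "((\<lambda>t. x0 + integral {t0..t} (\<lambda>s. f (s, x s))) has_vector_derivative f (t, x t)) (at t within {t0..t+1})"
      using integral_has_vector_derivative[OF fint(2)[OF xc[of "t + 1"]], of t] t
      by (auto intro!: derivative_eq_intros)
    then have "(x has_vector_derivative f (t, x t)) (at t within {t0..t+1})"
      by (rule has_vector_derivative_transform[rotated 2]) (use eq t in auto)
    moreover have "at t within {t0..t+1} = at t within {t0..}"
      by (rule at_within_nhd[of _ "{..<t+1}"]) auto
    ultimately show ?thesis by (simp add: has_real_derivative_iff_has_vector_derivative)
  qed
  moreover have "x t0 = x0" using eq[of t0] by simp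
  ultimately show ?thesis unfolding is_solution_def by blast
qed

lemma smooth_bounded_solution_exists:
  assumes s: "smooth_fun f" and bd: "\<And>z. \<bar>f z\<bar> \<le> K"
  shows "\<exists>x. is_solution f t0 x0 x"
proof (rule picard_global[OF _ bd])
  show "continuous_on UNIV f" using s Ck.simps(1) unfolding smooth_fun_def by blast
  fix R :: real
  have "Ck (Suc 0) f" using s by (simp only: smooth_fun_def)
  then obtain f' where f': "\<And>z. (f has_derivative f' z) (at z)" "\<And>v. continuous_on UNIV (\<lambda>z. f' z v)"
    by auto
  have "bounded ((\<lambda>z. f' z (0, 1)) ` ({- R..R} \<times> {- R..R}))"
    by (intro compact_imp_bounded compact_continuous_image compact_Times compact_Icc
        continuous_on_subset[OF f'(2)]) auto
  then obtain C where C: "\<And>t x. t \<in> {-R..R} \<Longrightarrow> x \<in> {-R..R} \<Longrightarrow> \<bar>f' (t, x) (0, 1)\<bar> \<le> C"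
    unfolding bounded_iff by fastforce
  have "\<bar>f (t, x) - f (t, y)\<bar> \<le> C * \<bar>x - y\<bar>" if "\<bar>t\<bar> \<le> R" "\<bar>x\<bar> \<le> R" "\<bar>y\<bar> \<le> R" for t x y
  proof -
    have d: "((\<lambda>x. f (t, x)) has_real_derivative f' (t, x) (0, 1)) (at x)" for x
    proof -
      have "((\<lambda>x. (t, x)) has_derivative (\<lambda>h. (0, h))) (at x)"
        by (auto intro!: derivative_eq_intros)
      from has_derivative_compose[OF this f'(1)]
      have "((\<lambda>x. f (t, x)) has_derivative (\<lambda>h. f' (t, x) (0, h))) (at x)" .
      moreover have "(\<lambda>h. f' (t, x) (0, h)) = (*) (f' (t, x) (0, 1))"
      proof
        fix h
        show "f' (t, x) (0, h) = f' (t, x) (0, 1) * h"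
          using linear_scale[OF has_derivative_linear[OF f'(1)], of "(t, x)" h "(0, 1)"]
          by (simp add: mult.commute)
      qed
      ultimately show ?thesis by (simp add: has_field_derivative_def)
    qed
    have "norm (f (t, x) - f (t, y)) \<le> C * norm (x - y)"
      by (rule field_differentiable_bound[of "{-R..R}" _ "\<lambda>x. f' (t, x) (0, 1)"])
        (use that C[of t] d in \<open>auto simp: abs_le_iff intro: has_field_derivative_at_within\<close>)
    then show ?thesis by simp
  qed
  then show "\<exists>C. \<forall>t x y. \<bar>t\<bar> \<le> R \<longrightarrow> \<bar>x\<bar> \<le> R \<longrightarrow> \<bar>y\<bar> \<le> R \<longrightarrow> \<bar>f (t, x) - f (t, y)\<bar> \<le> C * \<bar>x - y\<bar>"
    by blast
qed

section \<open>A pair of Poisson point sets\<close>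

text \<open>A configuration \<open>\<omega>\<close> encodes two point sets on the line, the supports of \<open>\<lambda>s. \<omega> (s, 0)\<close> and
  \<open>\<lambda>s. \<omega> (s, 1)\<close>; its values elsewhere are never inspected.\<close>

definition void_event :: "(bool \<Rightarrow> real set) \<Rightarrow> (real \<times> real \<Rightarrow> real) set" where
  "void_event U = {\<omega>. \<forall>i. \<forall>s\<in>U i. \<omega> (s, of_bool i) = 0}"

text \<open>Openness lets a point in the window be detected by rational intervals, which is what
  measurability needs. Boundedness gives finite measure and restricts attention to finitely many
  unit cells.\<close>

definition open_windows :: "(bool \<Rightarrow> real set) set" where
  "open_windows = {U. \<forall>i. open (U i) \<and> bounded (U i)}"

definition unit_cell :: "int \<Rightarrow> real set" where
  "unit_cell m = {of_int m..<of_int m + 1}"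

text \<open>The Poisson process on one cell: a Poisson number of points with independent uniform
  positions. An infinite sequence of positions is drawn and only the initial segment counted by the
  first component is read.\<close>

definition cell_measure :: "int \<Rightarrow> (nat \<times> (nat \<Rightarrow> real)) measure" where
  "cell_measure m = measure_pmf (poisson_pmf 1) \<Otimes>\<^sub>M
     (\<Pi>\<^sub>M j\<in>UNIV. uniform_measure lborel (unit_cell m))"

definition cell_void :: "real set \<Rightarrow> (nat \<times> (nat \<Rightarrow> real)) set" where
  "cell_void S = {p. \<forall>j<fst p. snd p j \<notin> S}"

lemma prob_space_uniform_cell: "prob_space (uniform_measure lborel (unit_cell m))"
  by (rule prob_space_uniform_measure) (auto simp: unit_cell_def)

lemma product_prob_space_uniform_cell:
  "product_prob_space (\<lambda>j::nat. uniform_measure lborel (unit_cell m))"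
  by (rule product_prob_spaceI) (rule prob_space_uniform_cell)

lemma prob_space_cell_measure: "prob_space (cell_measure m)"
  unfolding cell_measure_def
  by (intro prob_space_pair prob_space_PiM prob_space_uniform_cell) (rule measure_pmf.prob_space_axioms)

lemma space_cell_measure: "space (cell_measure m) = UNIV"
  by (auto simp: cell_measure_def space_pair_measure space_PiM)

lemma cell_void_sets:
  assumes S: "S \<in> sets borel"
  shows "cell_void S \<in> sets (cell_measure m)"
proof -
  note S[measurable]
  have "{p \<in> space (cell_measure m). \<forall>j. j < fst p \<longrightarrow> snd p j \<notin> S} \<in> sets (cell_measure m)"
    unfolding cell_measure_def by measurable
  then show ?thesis by (simp add: cell_void_def space_cell_measure)
qed

text \<open>Given n points, all miss S with probability (1 - \<kappa>)^n. Averaging over the Poisson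
  number sums the exponential series to exp(-1) exp(1 - \<kappa>).\<close>

lemma emeasure_cell_void:
  assumes S: "S \<in> sets borel"
  shows "emeasure (cell_measure m) (cell_void S) = ennreal (exp (- measure lborel (unit_cell m \<inter> S)))"
proof -
  define \<kappa> where "\<kappa> = measure lborel (unit_cell m \<inter> S)"
  let ?u = "uniform_measure lborel (unit_cell m)"
  interpret product_prob_space "\<lambda>j::nat. ?u" UNIV by (rule product_prob_space_uniform_cell)
  have "sigma_finite_measure (\<Pi>\<^sub>M j\<in>(UNIV::nat set). ?u)"
    by (intro prob_space_imp_sigma_finite prob_space_PiM prob_space_uniform_cell)
  note pair_alt = sigma_finite_measure.emeasure_pair_measure_alt[OF this]
  have cell1: "measure lborel (unit_cell m) = 1" "emeasure lborel (unit_cell m) = 1"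
    by (auto simp: unit_cell_def)
  have fin: "emeasure lborel (unit_cell m \<inter> S) < \<infinity>"
    using emeasure_mono[of "unit_cell m \<inter> S" "unit_cell m" lborel] cell1(2)
    by (auto simp: unit_cell_def intro: le_less_trans)
  have \<kappa>1: "0 \<le> \<kappa>" "\<kappa> \<le> 1"
  proof -
    show "0 \<le> \<kappa>" by (simp add: \<kappa>_def)
    show "\<kappa> \<le> 1" unfolding \<kappa>_def cell1(1)[symmetric]
      by (rule measure_mono_fmeasurable) (use S in \<open>auto simp: unit_cell_def fmeasurable_def\<close>)
  qed
  have u: "emeasure ?u (- S) = ennreal (1 - \<kappa>)"
  proof -
    have "emeasure ?u S = ennreal \<kappa>"
      using S cell1(2) fin divide_ennreal[of \<kappa> 1] \<kappa>1
      by (subst emeasure_uniform_measure) (auto simp: unit_cell_def \<kappa>_def emeasure_eq_ennreal_measure)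
    moreover have "emeasure ?u (- S) = 1 - emeasure ?u S"
      using emeasure_compl[of S ?u] S prob_space.emeasure_space_1[OF prob_space_uniform_cell, of m]
        finite_measure.emeasure_finite[OF prob_space.finite_measure[OF prob_space_uniform_cell], of m S]
      by (auto simp: Compl_eq_Diff_UNIV)
    ultimately show ?thesis using \<kappa>1 by (simp add: ennreal_minus[symmetric] del: ennreal_minus)
  qed
  have slice: "emeasure (\<Pi>\<^sub>M j\<in>UNIV. ?u) (Pair n -` cell_void S) = ennreal ((1 - \<kappa>) ^ n)" for n
  proof -
    have "Pair n -` cell_void S = {x \<in> space (\<Pi>\<^sub>M j\<in>UNIV. ?u). \<forall>j\<in>{..<n}. x j \<in> - S}"
      by (auto simp: cell_void_def space_PiM)
    also have "emeasure (\<Pi>\<^sub>M j\<in>UNIV. ?u) \<dots> = (\<Prod>j<n. emeasure ?u (- S))"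
      using S by (intro emeasure_PiM_Collect) auto
    also have "\<dots> = ennreal ((1 - \<kappa>) ^ n)" using \<kappa>1 by (simp add: u ennreal_power)
    finally show ?thesis .
  qed
  have "emeasure (cell_measure m) (cell_void S) =
      (\<integral>\<^sup>+n. ennreal ((1 - \<kappa>) ^ n) \<partial>measure_pmf (poisson_pmf 1))"
    using cell_void_sets[OF S, of m] unfolding cell_measure_def
    by (subst pair_alt) (auto simp: slice)
  also have "\<dots> = (\<integral>\<^sup>+n. ennreal (exp (-1) * ((1 - \<kappa>) ^ n /\<^sub>R fact n)) \<partial>count_space UNIV)"
    unfolding nn_integral_measure_pmf using \<kappa>1
    by (intro nn_integral_cong) (auto simp: ennreal_mult[symmetric] field_simps)
  also have "\<dots> = (\<Sum>n. ennreal (exp (-1) * ((1 - \<kappa>) ^ n /\<^sub>R fact n)))"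
    by (rule nn_integral_count_space_nat)
  also have "\<dots> = ennreal (exp (-1) * exp (1 - \<kappa>))"
    using \<kappa>1 by (intro suminf_ennreal_eq sums_mult exp_converges) auto
  also have "exp (-1) * exp (1 - \<kappa>) = exp (- \<kappa>)" by (simp add: exp_add[symmetric])
  finally show ?thesis by (simp add: \<kappa>_def)
qed

text \<open>The clause \<open>s \<in> unit_cell m\<close> discards positions drawn outside their own
  cell, a null event. With it, voidness splits into conditions on single cells for every sample and
  not only almost surely.\<close>

definition config :: "(int \<times> bool \<Rightarrow> nat \<times> (nat \<Rightarrow> real)) \<Rightarrow> real \<times> real \<Rightarrow> real" where
  "config q = (\<lambda>(s, r). of_bool (\<exists>m i j. j < fst (q (m, i)) \<and> s = snd (q (m, i)) j \<and>
      s \<in> unit_cell m \<and> r = of_bool i))"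

lemma config_void_iff:
  "config q \<in> void_event U \<longleftrightarrow> (\<forall>m i. q (m, i) \<in> cell_void (unit_cell m \<inter> U i))"
proof (intro iffI allI)
  fix m i
  assume void: "config q \<in> void_event U"
  have "snd (q (m, i)) j \<notin> U i" if "j < fst (q (m, i))" "snd (q (m, i)) j \<in> unit_cell m" for j
  proof
    assume "snd (q (m, i)) j \<in> U i"
    then have "config q (snd (q (m, i)) j, of_bool i) = 0" using void by (simp add: void_event_def)
    then show False using that unfolding config_def by auto
  qed
  then show "q (m, i) \<in> cell_void (unit_cell m \<inter> U i)" by (auto simp: cell_void_def)
next
  assume cells: "\<forall>m i. q (m, i) \<in> cell_void (unit_cell m \<inter> U i)"
  have "\<not> (\<exists>m j. j < fst (q (m, i)) \<and> s = snd (q (m, i)) j \<and> s \<in> unit_cell m)" if "s \<in> U i" for i s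
    using cells that unfolding cell_void_def by blast
  then have "config q (s, of_bool i) = 0" if "s \<in> U i" for i s
    using that unfolding config_def by (cases i) (auto simp: of_bool_def split: if_splits)
  then show "config q \<in> void_event U" unfolding void_event_def by blast
qed

lemma unit_cell_borel[measurable]: "unit_cell m \<in> sets borel"
  by (simp add: unit_cell_def)

lemma disjoint_unit_cells: "disjoint_family_on unit_cell A"
proof -
  have "m = n" if "x \<in> unit_cell m" "x \<in> unit_cell n" for x m n
    using that floor_unique[of m x] floor_unique[of n x] by (auto simp: unit_cell_def)
  then show ?thesis by (auto simp: disjoint_family_on_def)
qed

lemma measure_sum_unit_cells:
  assumes "U \<in> sets borel" "U \<subseteq> {-real N..<real N}"
  shows "(\<Sum>m=-int N..<int N. measure lborel (unit_cell m \<inter> U)) = measure lborel U"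
proof -
  have "U = (\<Union>m\<in>{-int N..<int N}. unit_cell m \<inter> U)"
  proof
    show "U \<subseteq> (\<Union>m\<in>{-int N..<int N}. unit_cell m \<inter> U)"
    proof
      fix x assume x: "x \<in> U"
      then have "- real N \<le> x" "x < real N" using assms(2) by auto
      then have "\<lfloor>x\<rfloor> \<in> {-int N..<int N}" by (auto simp: le_floor_iff floor_less_iff)
      moreover have "x \<in> unit_cell \<lfloor>x\<rfloor>" by (simp add: unit_cell_def)
      ultimately show "x \<in> (\<Union>m\<in>{-int N..<int N}. unit_cell m \<inter> U)" using x by blast
    qed
  qed auto
  then have "measure lborel U = measure lborel (\<Union>m\<in>{-int N..<int N}. unit_cell m \<inter> U)" by simp
  also have "\<dots> = (\<Sum>m=-int N..<int N. measure lborel (unit_cell m \<inter> U))"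
  proof (rule measure_finite_Union)
    show "disjoint_family_on (\<lambda>m. unit_cell m \<inter> U) {- int N..<int N}"
      using disjoint_unit_cells by (auto simp: disjoint_family_on_def)
    show "emeasure lborel (unit_cell m \<inter> U) \<noteq> \<infinity>" for m
      using emeasure_mono[of "unit_cell m \<inter> U" "unit_cell m" lborel]
      by (auto simp: unit_cell_def top_unique)
  qed (use assms in \<open>auto simp: unit_cell_def\<close>)
  finally show ?thesis by simp
qed

text \<open>Two independent Poisson processes of unit intensity, described by their void
  probabilities on an intersection-stable generator. Independence is encoded by the sum over
  \<open>i\<close> in the exponent.\<close>

locale poisson_pair = prob_space M for M :: "(real \<times> real \<Rightarrow> real) measure" +
  assumes sets_M: "sets M = sigma_sets UNIV (void_event ` open_windows)"
    and prob_void: "U \<in> open_windows \<Longrightarrow>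
      measure M (void_event U) = exp (- (\<Sum>i\<in>UNIV. measure lborel (U i)))"

lemma poisson_pair_exists: "\<exists>M. poisson_pair M"
proof -
  let ?Q = "\<Pi>\<^sub>M k\<in>(UNIV::(int \<times> bool) set). cell_measure (fst k)"
  interpret P: product_prob_space "\<lambda>k::int \<times> bool. cell_measure (fst k)" UNIV
    by (rule product_prob_spaceI) (rule prob_space_cell_measure)
  have spQ: "space ?Q = UNIV" by (auto simp: space_PiM space_cell_measure)
  have vimage: "config -` void_event U = (\<Inter>k. {q. q k \<in> cell_void (unit_cell (fst k) \<inter> U (snd k))})" for U
    by (auto simp: config_void_iff)
  have comp_sets: "{q. q k \<in> cell_void (unit_cell (fst k) \<inter> U (snd k))} \<in> sets ?Q"
    if "U \<in> open_windows" for U and k :: "int \<times> bool"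
  proof -
    have "cell_void (unit_cell (fst k) \<inter> U (snd k)) \<in> sets (cell_measure (fst k))"
      using that by (intro cell_void_sets) (auto simp: open_windows_def)
    from measurable_sets[OF measurable_component_singleton[of k UNIV "\<lambda>k. cell_measure (fst k)"] this]
    show ?thesis by (simp add: spQ vimage_def)
  qed
  have emb_sets: "config -` void_event U \<in> sets ?Q" if "U \<in> open_windows" for U
    unfolding vimage using comp_sets[OF that] by (intro sets.countable_INT') auto
  have meas: "config \<in> measurable ?Q (sigma UNIV (void_event ` open_windows))"
    by (rule measurable_measure_of) (auto simp: spQ emb_sets)
  define M where "M = distr ?Q (sigma UNIV (void_event ` open_windows)) config"
  have "prob_space M" unfolding M_def by (rule P.P.prob_space_distr[OF meas])
  moreover have "sets M = sigma_sets UNIV (void_event ` open_windows)" by (simp add: M_def)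
  moreover have "measure M (void_event U) = exp (- (\<Sum>i\<in>UNIV. measure lborel (U i)))"
    if U: "U \<in> open_windows" for U
  proof -
    have Ub: "U i \<in> sets borel" for i using U by (auto simp: open_windows_def)
    have "bounded (U False \<union> U True)" using U by (auto simp: open_windows_def)
    then obtain B where B: "\<And>x. x \<in> U False \<union> U True \<Longrightarrow> \<bar>x\<bar> \<le> B" by (auto simp: bounded_iff)
    obtain N :: nat where N: "B < real N" using reals_Archimedean2 by blast
    have UN: "U i \<subseteq> {-real N..<real N}" for i
    proof
      fix x assume "x \<in> U i"
      then have "\<bar>x\<bar> \<le> B" using B by (cases i) auto
      then show "x \<in> {-real N..<real N}" using N by auto
    qed
    let ?J = "{-int N..<int N} \<times> (UNIV :: bool set)"
    have cellN: "m \<in> {-int N..<int N}" if "x \<in> unit_cell m" "x \<in> U i" for x m i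
    proof -
      have "- real N \<le> x" "x < real N" using UN that(2) by fastforce+
      then have "real_of_int (- int N) < real_of_int (m + 1)" "real_of_int m < real_of_int (int N)"
        using that(1) by (auto simp: unit_cell_def)
      then show ?thesis unfolding of_int_less_iff by auto
    qed
    \<comment> \<open>Cells outside the finite index set do not meet the window, so their condition
      is vacuous and the infinite product measure is evaluated on a finite cylinder.\<close>
    have "config -` void_event U = {q \<in> space ?Q. \<forall>k\<in>?J. q k \<in> cell_void (unit_cell (fst k) \<inter> U (snd k))}"
    proof -
      have "unit_cell m \<inter> U i = {}" if "(m, i) \<notin> ?J" for m i using cellN that by blast
      then have "q (m, i) \<in> cell_void (unit_cell m \<inter> U i)" if "(m, i) \<notin> ?J" for q m i
        using that by (simp add: cell_void_def)
      then show ?thesis unfolding set_eq_iff vimage_eq config_void_iff mem_Collect_eq spQ Ball_def split_paired_All fst_conv snd_conv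
        by blast
    qed
    also have "emeasure ?Q \<dots> = (\<Prod>k\<in>?J. emeasure (cell_measure (fst k)) (cell_void (unit_cell (fst k) \<inter> U (snd k))))"
      using Ub by (intro P.emeasure_PiM_Collect) (auto intro!: cell_void_sets)
    also have "\<dots> = (\<Prod>k\<in>?J. ennreal (exp (- measure lborel (unit_cell (fst k) \<inter> U (snd k)))))"
      using Ub by (intro prod.cong refl, subst emeasure_cell_void) (auto simp: Int_assoc[symmetric])
    also have "\<dots> = ennreal (\<Prod>k\<in>?J. exp (- measure lborel (unit_cell (fst k) \<inter> U (snd k))))"
      by (rule prod_ennreal) simp
    also have "(\<Prod>k\<in>?J. exp (- measure lborel (unit_cell (fst k) \<inter> U (snd k)))) =
        exp (- (\<Sum>k\<in>?J. measure lborel (unit_cell (fst k) \<inter> U (snd k))))"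
      by (simp add: exp_sum[symmetric] sum_negf)
    also have "(\<Sum>k\<in>?J. measure lborel (unit_cell (fst k) \<inter> U (snd k))) =
        (\<Sum>i\<in>UNIV. \<Sum>m=-int N..<int N. measure lborel (unit_cell m \<inter> U i))"
      by (subst sum.swap) (simp add: sum.cartesian_product case_prod_beta)
    also have "\<dots> = (\<Sum>i\<in>UNIV. measure lborel (U i))"
      by (simp only: measure_sum_unit_cells[OF Ub UN])
    finally have "emeasure ?Q (config -` void_event U) = ennreal (exp (- (\<Sum>i\<in>UNIV. measure lborel (U i))))" .
    moreover have "emeasure M (void_event U) = emeasure ?Q (config -` void_event U)"
      unfolding M_def using U meas by (subst emeasure_distr) (auto simp: spQ)
    ultimately show ?thesis by (simp add: measure_def)
  qed
  ultimately have "poisson_pair M"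
    by (intro poisson_pair.intro) (auto simp: poisson_pair_axioms_def)
  then show ?thesis by blast
qed

section \<open>The translation action and its weak mixing\<close>

definition ell :: "real \<Rightarrow> real \<Rightarrow> bool \<Rightarrow> real \<times> real \<Rightarrow> real" where
  "ell u0 u1 i g = (if i then u1 * fst g - snd g else snd g - u0 * fst g)"

lemma bounded_linear_ell: "bounded_linear (ell u0 u1 i)"
proof -
  have "bounded_linear (\<lambda>g::real \<times> real. u1 * fst g - snd g)" "bounded_linear (\<lambda>g::real \<times> real. snd g - u0 * fst g)"
    by (intro bounded_linear_intros)+
  then show ?thesis by (cases i) (auto simp: ell_def[abs_def])
qed

lemma ell_0 [simp]: "ell u0 u1 i 0 = 0"
  by (simp add: ell_def)

lemma ell_add: "ell u0 u1 i (g + h) = ell u0 u1 i g + ell u0 u1 i h"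
  by (simp add: ell_def algebra_simps)

text \<open>Every layer r is shifted, also those that encode no points, so that the action laws hold
  for all functions \<omega> exactly.\<close>

definition shift_action :: "real \<Rightarrow> real \<Rightarrow> real \<times> real \<Rightarrow> (real \<times> real \<Rightarrow> real) \<Rightarrow> real \<times> real \<Rightarrow> real" where
  "shift_action u0 u1 g \<omega> = (\<lambda>(s, r). \<omega> (s + ell u0 u1 (r \<noteq> 0) g, r))"

lemma shift_action_of_bool [simp]:
  "shift_action u0 u1 g \<omega> (s, of_bool i) = \<omega> (s + ell u0 u1 i g, of_bool i)"
  by (cases i) (auto simp: shift_action_def)

lemma shift_action_0: "shift_action u0 u1 0 \<omega> = \<omega>"
  by (auto simp: shift_action_def)

lemma shift_action_add: "shift_action u0 u1 (g + h) \<omega> = shift_action u0 u1 g (shift_action u0 u1 h \<omega>)"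
  by (auto simp: shift_action_def ell_add add.assoc)

lemma shift_action_void_iff:
  "shift_action u0 u1 g \<omega> \<in> void_event U \<longleftrightarrow> \<omega> \<in> void_event (\<lambda>i. (+) (ell u0 u1 i g) ` U i)"
  by (simp add: void_event_def add.commute)

lemma void_event_Int: "void_event U \<inter> void_event W = void_event (\<lambda>i. U i \<union> W i)"
  by (auto simp: void_event_def)

lemma open_windows_Un: "U \<in> open_windows \<Longrightarrow> W \<in> open_windows \<Longrightarrow> (\<lambda>i. U i \<union> W i) \<in> open_windows"
  by (auto simp: open_windows_def)

lemma open_windows_translation: "U \<in> open_windows \<Longrightarrow> (\<lambda>i. (+) (a i) ` U i) \<in> open_windows"
  by (auto simp: open_windows_def open_translation bounded_translation)

lemma Int_stable_void: "Int_stable (void_event ` open_windows)"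
  by (auto simp: Int_stable_def void_event_Int open_windows_Un)

lemma void_event_empty: "void_event (\<lambda>i. {}) = UNIV"
  by (simp add: void_event_def)

lemma measure_lborel_translation:
  assumes "open U"
  shows "measure lborel ((+) a ` U) = measure lborel (U :: real set)"
proof -
  have "measure lborel ((+) a ` U) = measure lebesgue ((+) a ` U)"
    using borel_open[OF open_translation[OF assms, of a]] by (subst measure_completion) auto
  also have "\<dots> = measure lebesgue U" by (rule measure_translation)
  also have "\<dots> = measure lborel U" using assms by (subst measure_completion) auto
  finally show ?thesis .
qed

definition hit_event :: "bool \<Rightarrow> real set \<Rightarrow> (real \<times> real \<Rightarrow> real) set" where
  "hit_event i I = {\<omega>. \<exists>s\<in>I. \<omega> (s, of_bool i) \<noteq> 0}"

lemma hit_event_eq: "hit_event i I = - void_event (\<lambda>j. if j = i then I else {})"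
  by (auto simp: hit_event_def void_event_def)

context poisson_pair
begin

lemma space_M [simp]: "space M = UNIV"
proof -
  have "UNIV \<in> sets M" unfolding sets_M by (rule sigma_sets_top)
  then show ?thesis using sets.sets_into_space by blast
qed

lemma void_event_sets: "U \<in> open_windows \<Longrightarrow> void_event U \<in> sets M"
  by (auto simp: sets_M)

lemma hit_event_sets:
  assumes "open I" "bounded I"
  shows "hit_event i I \<in> sets M"
proof -
  have "void_event (\<lambda>j. if j = i then I else {}) \<in> sets M"
    using assms by (intro void_event_sets) (auto simp: open_windows_def)
  then show ?thesis unfolding hit_event_eq using sets.compl_sets by (force simp: Compl_eq_Diff_UNIV)
qed

text \<open>That a shifted configuration has a point in a window is an uncountable union over
  points. Since windows are open, it is witnessed by a rational interval that contains a point of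
  \<omega> and that the inverse shift carries, closure included, into the window. This separates g
  from \<omega> in a countable union of rectangles.\<close>

lemma shift_joint_measurable:
  "(\<lambda>(g, \<omega>). shift_action u0 u1 g \<omega>) \<in> measurable (borel \<Otimes>\<^sub>M M) M"
proof (rule measurable_sigma_sets[OF sets_M])
  fix Y assume "Y \<in> void_event ` open_windows"
  then obtain U where U: "U \<in> open_windows" and Y: "Y = void_event U" by blast
  have oU: "open (U i)" for i using U by (simp add: open_windows_def)
  define G where "G i p q = {g :: real \<times> real. \<forall>x\<in>{p..q}. x - ell u0 u1 i g \<in> U i}" for i and p q :: real
  define H where "H i p q = hit_event i {p<..<q}" for i and p q :: real
  have G: "G i p q \<in> sets borel" for i p q
  proof -
    \<comment> \<open>The differences of a compact and a closed set form a closed set, so the shifts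
      that carry all of [p, q] into the window form an open one.\<close>
    have "closed (\<Union>x\<in>{p..q}. \<Union>y\<in>- U i. {x - y})"
      by (intro compact_closed_differences) (use oU in auto)
    then have "open (- (\<Union>x\<in>{p..q}. \<Union>y\<in>- U i. {x - y}))" by (rule open_Compl)
    moreover have "- (\<Union>x\<in>{p..q}. \<Union>y\<in>- U i. {x - y}) = {a. \<forall>x\<in>{p..q}. x - a \<in> U i}"
    proof -
      have "(\<exists>y\<in>- U i. a = x - y) \<longleftrightarrow> x - a \<notin> U i" for a x by (auto intro: bexI[of _ "x - a"])
      then show ?thesis by auto
    qed
    ultimately have "open {a. \<forall>x\<in>{p..q}. x - a \<in> U i}" by simp
    then have "open (ell u0 u1 i -` {a. \<forall>x\<in>{p..q}. x - a \<in> U i})"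
      by (intro open_vimage linear_continuous_on bounded_linear_ell)
    then show ?thesis by (simp add: G_def vimage_def)
  qed
  have H: "H i p q \<in> sets M" for i p q
    unfolding H_def by (rule hit_event_sets) auto
  define R where "R = (\<Union>i\<in>UNIV. \<Union>p\<in>\<rat>. \<Union>q\<in>\<rat>. G i p q \<times> H i p q)"
  have R_sets: "R \<in> sets (borel \<Otimes>\<^sub>M M)"
    unfolding R_def
  proof (rule sets.finite_UN)
    show "(\<Union>p\<in>\<rat>. \<Union>q\<in>\<rat>. G i p q \<times> H i p q) \<in> sets (borel \<Otimes>\<^sub>M M)" for i
      by (intro sets.countable_UN'[OF countable_rat] image_subsetI pair_measureI G H)
  qed simp
  have "(\<lambda>(g, \<omega>). shift_action u0 u1 g \<omega>) -` Y = UNIV - R"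
  proof -
    have R1: "(g, \<omega>) \<in> R" if nv: "shift_action u0 u1 g \<omega> \<notin> void_event U" for g \<omega>
    proof -
      obtain i s where "s \<in> U i" "shift_action u0 u1 g \<omega> (s, of_bool i) \<noteq> 0"
        using nv unfolding void_event_def by blast
      then have s: "s \<in> U i" "\<omega> (s + ell u0 u1 i g, of_bool i) \<noteq> 0" by simp_all
      obtain d where d: "d > 0" "ball s d \<subseteq> U i" using oU s(1) openE by blast
      let ?y = "s + ell u0 u1 i g"
      obtain p where p: "p \<in> \<rat>" "?y - d < p" "p < ?y" using Rats_dense_in_real[of "?y - d" ?y] d(1) by auto
      obtain q where q: "q \<in> \<rat>" "?y < q" "q < ?y + d" using Rats_dense_in_real[of ?y "?y + d"] d(1) by auto
      have "x - ell u0 u1 i g \<in> U i" if "x \<in> {p..q}" for x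
        using that p q d(2) by (intro subsetD[OF d(2)]) (auto simp: dist_real_def abs_less_iff)
      then have "g \<in> G i p q" by (simp add: G_def)
      moreover have "\<omega> \<in> H i p q" using p q s(2) by (auto simp: H_def hit_event_def)
      ultimately show ?thesis unfolding R_def using p q by blast
    qed
    have R2: "shift_action u0 u1 g \<omega> \<notin> void_event U" if R: "(g, \<omega>) \<in> R" for g \<omega>
    proof -
      obtain i p q where gh: "g \<in> G i p q" "\<omega> \<in> H i p q" using R unfolding R_def by blast
      obtain s where s: "s \<in> {p<..<q}" "\<omega> (s, of_bool i) \<noteq> 0"
        using gh(2) by (auto simp: H_def hit_event_def)
      have "s - ell u0 u1 i g \<in> U i" using gh(1) s(1) by (auto simp: G_def)
      moreover have "shift_action u0 u1 g \<omega> (s - ell u0 u1 i g, of_bool i) \<noteq> 0" using s(2) by simp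
      ultimately show ?thesis unfolding void_event_def by blast
    qed
    show ?thesis
    proof (intro set_eqI)
      fix z :: "(real \<times> real) \<times> (real \<times> real \<Rightarrow> real)"
      obtain g \<omega> where z: "z = (g, \<omega>)" by (cases z)
      have "shift_action u0 u1 g \<omega> \<in> void_event U \<longleftrightarrow> (g, \<omega>) \<notin> R"
        using R1[of g \<omega>] R2[of g \<omega>] by metis
      then show "z \<in> (\<lambda>(g, \<omega>). shift_action u0 u1 g \<omega>) -` Y \<longleftrightarrow> z \<in> UNIV - R"
        unfolding z Y by simp
    qed
  qed
  then have "(\<lambda>(g, \<omega>). shift_action u0 u1 g \<omega>) -` Y \<inter> space (borel \<Otimes>\<^sub>M M) = space (borel \<Otimes>\<^sub>M M) - R"
    by auto
  then show "(\<lambda>(g, \<omega>). shift_action u0 u1 g \<omega>) -` Y \<inter> space (borel \<Otimes>\<^sub>M M) \<in> sets (borel \<Otimes>\<^sub>M M)"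
    using sets.compl_sets[OF R_sets] by simp
qed auto

lemma shift_measurable: "shift_action u0 u1 g \<in> measurable M M"
  using measurable_compose[OF measurable_Pair1' shift_joint_measurable, of g u0 u1] by simp

lemma distr_shift: "distr M M (shift_action u0 u1 g) = M"
proof (rule measure_eqI_generator_eq[OF Int_stable_void, where A = "\<lambda>_. UNIV" and \<Omega> = UNIV])
  fix X assume "X \<in> void_event ` open_windows"
  then obtain U where U: "U \<in> open_windows" and X: "X = void_event U" by blast
  have "shift_action u0 u1 g -` X \<inter> space M = void_event (\<lambda>i. (+) (ell u0 u1 i g) ` U i)"
    unfolding X by (auto simp: shift_action_void_iff)
  then have "emeasure (distr M M (shift_action u0 u1 g)) X = emeasure M (void_event (\<lambda>i. (+) (ell u0 u1 i g) ` U i))"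
    using U by (simp add: emeasure_distr[OF shift_measurable] X void_event_sets)
  also have "\<dots> = emeasure M X"
    unfolding X emeasure_eq_measure prob_void[OF U] prob_void[OF open_windows_translation[OF U]]
    using U by (simp add: measure_lborel_translation open_windows_def)
  finally show "emeasure (distr M M (shift_action u0 u1 g)) X = emeasure M X" .
next
  have "(\<lambda>i. {}) \<in> open_windows" by (simp add: open_windows_def)
  then show "range (\<lambda>_. UNIV) \<subseteq> void_event ` open_windows" using void_event_empty by blast
  show "emeasure (distr M M (shift_action u0 u1 g)) UNIV \<noteq> \<infinity>"
    by (subst emeasure_distr[OF shift_measurable]) (auto simp: emeasure_eq_measure sets_M intro: sigma_sets_top)
qed (auto simp: sets_M)

lemma mp_action_shift: "mp_action M (shift_action u0 u1)"
  unfolding mp_action_def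
  using prob_space_axioms shift_joint_measurable shift_measurable distr_shift
  by (auto simp: shift_action_0 shift_action_add)

lemma prob_shift_vimage:
  "A \<in> sets M \<Longrightarrow> prob (shift_action u0 u1 g -` A) = prob A"
  using measure_distr[OF shift_measurable, of A u0 u1 g] by (simp add: distr_shift)

lemma shift_vimage_sets: "A \<in> sets M \<Longrightarrow> shift_action u0 u1 g -` A \<in> sets M"
  using measurable_sets[OF shift_measurable, of A] by simp

lemma prob_shift_Int_measurable:
  assumes "A \<in> sets M" "B \<in> sets M"
  shows "(\<lambda>g. prob (shift_action u0 u1 g -` A \<inter> B)) \<in> borel_measurable borel"
proof -
  let ?Q = "((\<lambda>(g, \<omega>). shift_action u0 u1 g \<omega>) -` A \<inter> space (borel \<Otimes>\<^sub>M M)) \<inter> (UNIV \<times> B)"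
  have "?Q \<in> sets (borel \<Otimes>\<^sub>M M)"
    using assms(2) by (intro sets.Int measurable_sets[OF shift_joint_measurable assms(1)] pair_measureI) auto
  then have "(\<lambda>g. emeasure M (Pair g -` ?Q)) \<in> borel_measurable borel"
    by (rule measurable_emeasure_Pair)
  moreover have "Pair g -` ?Q = shift_action u0 u1 g -` A \<inter> B" for g
    by (auto simp: space_pair_measure)
  ultimately have "(\<lambda>g. emeasure M (shift_action u0 u1 g -` A \<inter> B)) \<in> borel_measurable borel" by simp
  then have "(\<lambda>g. enn2real (emeasure M (shift_action u0 u1 g -` A \<inter> B))) \<in> borel_measurable borel"
    by measurable
  then show ?thesis by (simp add: measure_def)
qed

end

section \<open>Functions whose averages over large squares vanish\<close>

definition sq_box :: "real \<Rightarrow> (real \<times> real) set" where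
  "sq_box R = {g. max \<bar>fst g\<bar> \<bar>snd g\<bar> \<le> R}"

definition cesaro_null :: "(real \<times> real \<Rightarrow> real) \<Rightarrow> bool" where
  "cesaro_null f \<longleftrightarrow> ((\<lambda>R. (1 / (2 * R)^2) * (LINT g : sq_box R | lborel. f g)) \<longlongrightarrow> 0) at_top"

lemma sq_box_eq: "sq_box R = {-R..R} \<times> {-R..R}"
  by (auto simp: sq_box_def abs_le_iff)

lemma sq_box_borel [measurable]: "sq_box R \<in> sets borel"
  unfolding sq_box_eq by (intro borel_closed closed_Times) auto

lemma emeasure_sq_box: "R \<ge> 0 \<Longrightarrow> emeasure lborel (sq_box R) = ennreal ((2 * R)^2)"
  unfolding sq_box_eq lborel_prod[symmetric]
  by (subst lborel.emeasure_pair_measure_Times) (auto simp: ennreal_mult[symmetric] power2_eq_square)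

lemma set_integrable_sq_box:
  fixes f :: "real \<times> real \<Rightarrow> real"
  assumes [measurable]: "f \<in> borel_measurable borel" and "\<And>g. \<bar>f g\<bar> \<le> K" "R \<ge> 0"
  shows "set_integrable lborel (sq_box R) f"
  unfolding set_integrable_def
proof (rule Bochner_Integration.integrable_bound[where f = "\<lambda>g. K * indicator (sq_box R) g"])
  show "integrable lborel (\<lambda>g. K * indicator (sq_box R) g)"
    using emeasure_sq_box[OF assms(3)] by (intro integrable_mult_right) (simp add: integrable_indicator_iff)
  have "K \<ge> 0" using assms(2)[of 0] by linarith
  then show "AE g in lborel. norm (indicat_real (sq_box R) g *\<^sub>R f g) \<le> norm (K * indicator (sq_box R) g)"
    using assms(2) by (auto simp: indicator_def)
qed measurable

text \<open>A slack of \<epsilon> contributes exactly \<epsilon> to every square average, so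
  approximation uniform in g is enough. This is what carries the passage to countable disjoint
  unions.\<close>

lemma cesaro_null_dominated:
  assumes f [measurable]: "f \<in> borel_measurable borel" and f0: "\<And>g. 0 \<le> f g" and fK: "\<And>g. f g \<le> K"
    and dom: "\<And>\<epsilon>. \<epsilon> > 0 \<Longrightarrow> \<exists>h K. h \<in> borel_measurable borel \<and> (\<forall>g. \<bar>h g\<bar> \<le> K) \<and> cesaro_null h \<and> (\<forall>g. f g \<le> h g + \<epsilon>)"
  shows "cesaro_null f"
  unfolding cesaro_null_def
proof (rule tendstoI)
  fix e :: real assume e: "e > 0"
  obtain h K' where h [measurable]: "h \<in> borel_measurable borel" and hK: "\<And>g. \<bar>h g\<bar> \<le> K'"
    and hn: "cesaro_null h" and fh: "\<And>g. f g \<le> h g + e / 2"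
    using dom[of "e / 2"] e by auto
  have "eventually (\<lambda>R. dist ((1 / (2 * R)^2) * (LINT g : sq_box R | lborel. h g)) 0 < e / 2) at_top"
    using hn e unfolding cesaro_null_def by (intro tendstoD) auto
  then show "eventually (\<lambda>R. dist ((1 / (2 * R)^2) * (LINT g : sq_box R | lborel. f g)) 0 < e) at_top"
    using eventually_gt_at_top[of 0]
  proof eventually_elim
    fix R :: real assume R: "0 < R" and *: "dist ((1 / (2 * R)^2) * (LINT g : sq_box R | lborel. h g)) 0 < e / 2"
    have ih: "set_integrable lborel (sq_box R) h" using set_integrable_sq_box[OF h hK] R by simp
    have ic: "set_integrable lborel (sq_box R) (\<lambda>_. e / 2)" by (rule set_integrable_sq_box[of _ "e / 2"]) (use R e in auto)
    have if': "set_integrable lborel (sq_box R) f" using set_integrable_sq_box[OF f, of K] f0 fK R by simp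
    have "(LINT g : sq_box R | lborel. f g) \<le> (LINT g : sq_box R | lborel. h g + e / 2)"
      by (rule set_integral_mono[OF if' set_integral_add(1)[OF ih ic]]) (rule fh)
    also have "\<dots> = (LINT g : sq_box R | lborel. h g) + (LINT g : sq_box R | lborel. e / 2)"
      by (rule set_integral_add(2)[OF ih ic])
    also have "(LINT g : sq_box R | lborel. e / 2) = (2 * R)^2 * (e / 2)"
      using emeasure_sq_box[of R] R by (simp add: set_lebesgue_integral_def measure_def)
    finally have "(1 / (2 * R)^2) * (LINT g : sq_box R | lborel. f g) \<le>
        (1 / (2 * R)^2) * ((LINT g : sq_box R | lborel. h g) + (2 * R)^2 * (e / 2))"
      by (intro mult_left_mono) auto
    also have "\<dots> = (1 / (2 * R)^2) * (LINT g : sq_box R | lborel. h g) + e / 2"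
      using R by (simp add: field_simps)
    also have "\<dots> < e" using *[unfolded dist_real_def] by linarith
    finally have "(1 / (2 * R)^2) * (LINT g : sq_box R | lborel. f g) < e" .
    moreover have "0 \<le> (LINT g : sq_box R | lborel. f g)"
      unfolding set_lebesgue_integral_def using f0 by (intro Bochner_Integration.integral_nonneg) simp
    ultimately show "dist ((1 / (2 * R)^2) * (LINT g : sq_box R | lborel. f g)) 0 < e"
      by (simp add: dist_real_def)
  qed
qed

lemma cesaro_null_add:
  assumes "f \<in> borel_measurable borel" "\<And>g. \<bar>f g\<bar> \<le> K" "h \<in> borel_measurable borel" "\<And>g. \<bar>h g\<bar> \<le> K'"
    and "cesaro_null f" "cesaro_null h"
  shows "cesaro_null (\<lambda>g. f g + h g)"
  unfolding cesaro_null_def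
proof (rule Lim_transform_eventually)
  show "((\<lambda>R. (1 / (2 * R)^2) * (LINT g : sq_box R | lborel. f g) + (1 / (2 * R)^2) * (LINT g : sq_box R | lborel. h g)) \<longlongrightarrow> 0) at_top"
    using tendsto_add[OF assms(5,6)[unfolded cesaro_null_def]] by simp
  show "eventually (\<lambda>R. (1 / (2 * R)^2) * (LINT g : sq_box R | lborel. f g) + (1 / (2 * R)^2) * (LINT g : sq_box R | lborel. h g) =
     (1 / (2 * R)^2) * (LINT g : sq_box R | lborel. f g + h g)) at_top"
    using eventually_ge_at_top[of 0]
  proof eventually_elim
    fix R :: real assume "0 \<le> R"
    then show "(1 / (2 * R)^2) * (LINT g : sq_box R | lborel. f g) + (1 / (2 * R)^2) * (LINT g : sq_box R | lborel. h g) =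
     (1 / (2 * R)^2) * (LINT g : sq_box R | lborel. f g + h g)"
      using set_integral_add(2)[OF set_integrable_sq_box[OF assms(1,2)] set_integrable_sq_box[OF assms(3,4)], of R]
      by (simp add: distrib_left)
  qed
qed

lemma cesaro_null_0: "cesaro_null (\<lambda>_. 0)"
  by (simp add: cesaro_null_def set_lebesgue_integral_def)

lemma cesaro_null_sum:
  assumes "\<And>i::nat. f i \<in> borel_measurable borel" "\<And>i g. \<bar>f i g\<bar> \<le> 1" "\<And>i. cesaro_null (f i)"
  shows "cesaro_null (\<lambda>g. \<Sum>i<n. f i g)"
proof (induction n)
  case 0
  then show ?case using cesaro_null_0 by simp
next
  case (Suc n)
  have "\<bar>\<Sum>i<n. f i g\<bar> \<le> real n" for g
    using sum_norm_bound[of "{..<n}" "\<lambda>i. f i g" 1] assms(2) by simp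
  then have "cesaro_null (\<lambda>g. (\<Sum>i<n. f i g) + f n g)"
    using assms Suc by (intro cesaro_null_add[of _ "real n" _ 1]) auto
  then show ?case by simp
qed

text \<open>Slicing by time, each slice of the strip is an interval of length 2C, so the strip
  covers area at most 4RC of a square of area 4R^2. The \<open>max C 0\<close> covers the empty
  strip of a negative C.\<close>

lemma cesaro_null_strip: "cesaro_null (indicator {g. \<bar>ell u0 u1 i g\<bar> \<le> C})"
proof -
  define v where "v = (if i then u1 else u0)"
  have S: "{g. \<bar>ell u0 u1 i g\<bar> \<le> C} = {g. \<bar>snd g - v * fst g\<bar> \<le> C}"
    by (auto simp: ell_def v_def abs_minus_commute)
  define S where "S = {g :: real \<times> real. \<bar>snd g - v * fst g\<bar> \<le> C}"
  have [measurable]: "S \<in> sets borel"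
    unfolding S_def by (intro borel_closed closed_Collect_le continuous_intros)
  have bound: "measure lborel (sq_box R \<inter> S) \<le> 2 * R * (2 * max C 0)" if R: "R > 0" for R
  proof -
    have "emeasure lborel (sq_box R \<inter> S) = (\<integral>\<^sup>+t. emeasure lborel (Pair t -` (sq_box R \<inter> S)) \<partial>lborel)"
      unfolding lborel_prod[symmetric] by (rule lborel.emeasure_pair_measure_alt) (unfold lborel_prod, simp)
    also have "\<dots> \<le> (\<integral>\<^sup>+t. ennreal (2 * max C 0) * indicator {-R..R} t \<partial>lborel)"
    proof (rule nn_integral_mono)
      fix t :: real
      have "emeasure lborel (Pair t -` (sq_box R \<inter> S)) \<le> emeasure lborel {v * t - max C 0..v * t + max C 0}"
        by (rule emeasure_mono) (auto simp: S_def)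
      also have "\<dots> = ennreal (2 * max C 0)" by simp
      finally have "emeasure lborel (Pair t -` (sq_box R \<inter> S)) \<le> ennreal (2 * max C 0)" .
      moreover have "Pair t -` (sq_box R \<inter> S) = {}" if "t \<notin> {-R..R}"
        using that by (auto simp: sq_box_eq)
      ultimately show "emeasure lborel (Pair t -` (sq_box R \<inter> S)) \<le> ennreal (2 * max C 0) * indicator {-R..R} t"
        by (cases "t \<in> {-R..R}") auto
    qed
    also have "\<dots> = ennreal (2 * max C 0) * ennreal (2 * R)"
      using R by (subst nn_integral_cmult_indicator) auto
    also have "\<dots> = ennreal (2 * R * (2 * max C 0))"
      using R by (simp add: ennreal_mult[symmetric] mult.commute)
    finally show ?thesis unfolding measure_def using R by (intro enn2real_leI) auto
  qed
  have "((\<lambda>R. max C 0 / R) \<longlongrightarrow> 0) at_top"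
    by (intro tendsto_divide_0[OF tendsto_const] filterlim_at_top_imp_at_infinity filterlim_ident)
  then have "((\<lambda>R. (1 / (2 * R)^2) * measure lborel (sq_box R \<inter> S)) \<longlongrightarrow> 0) at_top"
  proof (rule tendsto_sandwich[OF _ _ tendsto_const, rotated 2])
    show "eventually (\<lambda>R. 0 \<le> (1 / (2 * R)^2) * measure lborel (sq_box R \<inter> S)) at_top" by simp
    show "eventually (\<lambda>R. (1 / (2 * R)^2) * measure lborel (sq_box R \<inter> S) \<le> max C 0 / R) at_top"
      using eventually_gt_at_top[of 0]
    proof eventually_elim
      fix R :: real assume R: "0 < R"
      have "(1 / (2 * R)^2) * measure lborel (sq_box R \<inter> S) \<le> (1 / (2 * R)^2) * (2 * R * (2 * max C 0))"
        using bound[OF R] by (intro mult_left_mono) auto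
      also have "\<dots> = max C 0 / R" using R by (simp add: field_simps power2_eq_square)
      finally show "(1 / (2 * R)^2) * measure lborel (sq_box R \<inter> S) \<le> max C 0 / R" .
    qed
  qed
  moreover have "(LINT g : sq_box R | lborel. indicator S g) = measure lborel (sq_box R \<inter> S)" for R
  proof -
    have "(LINT g : sq_box R | lborel. indicator S g) = (LINT g | lborel. indicator (sq_box R \<inter> S) g)"
      unfolding set_lebesgue_integral_def by (intro Bochner_Integration.integral_cong) (auto simp: indicator_def)
    also have "\<dots> = measure lborel (sq_box R \<inter> S)"
      using Bochner_Integration.integral_indicator[of lborel "sq_box R \<inter> S"] by simp
    finally show ?thesis .
  qed
  ultimately show ?thesis unfolding S S_def[symmetric] cesaro_null_def by simp
qed

text \<open>The class of sets X with vanishing mean correlation is a Dynkin system because the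
  defect of a tail of a disjoint union is at most its probability, uniformly in the group element.\<close>

lemma (in prob_space) cesaro_null_dynkin:
  assumes sets: "sets M = sigma_sets UNIV E" and E: "Int_stable E" and sp: "space M = UNIV"
    and meas: "\<And>X. X \<in> sets M \<Longrightarrow> (\<lambda>g. D g X) \<in> borel_measurable borel"
    and bound: "\<And>g X. X \<in> sets M \<Longrightarrow> \<bar>D g X :: real\<bar> \<le> prob X"
    and D_compl: "\<And>g X. X \<in> sets M \<Longrightarrow> \<bar>D g (UNIV - X)\<bar> = \<bar>D g X\<bar>"
    and D_add: "\<And>g X Y. X \<in> sets M \<Longrightarrow> Y \<in> sets M \<Longrightarrow> X \<inter> Y = {} \<Longrightarrow> D g (X \<union> Y) = D g X + D g Y"
    and gen: "\<And>X. X \<in> E \<Longrightarrow> cesaro_null (\<lambda>g. \<bar>D g X\<bar>)"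
    and X: "X \<in> sets M"
  shows "cesaro_null (\<lambda>g. \<bar>D g X\<bar>)"
proof -
  have D_empty: "D g {} = 0" for g using bound[of "{}" g] by simp
  have "E \<subseteq> Pow UNIV" "X \<in> sigma_sets UNIV E" using X by (simp_all add: sets)
  with E show ?thesis
  proof (induction rule: sigma_sets_induct_disjoint)
    case (basic A)
    then show ?case by (rule gen)
  next
    case empty
    show ?case using cesaro_null_0 by (simp add: D_empty)
  next
    case (compl A)
    then show ?case using D_compl by (simp add: sets)
  next
    case (union A)
    have A: "A i \<in> sets M" for i using union by (auto simp: sets)
    show ?case
    proof (rule cesaro_null_dominated[where K = 1])
      show "(\<lambda>g. \<bar>D g (\<Union> (range A))\<bar>) \<in> borel_measurable borel"
        using A meas by (intro borel_measurable_abs) auto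
      show "\<bar>D g (\<Union> (range A))\<bar> \<le> 1" for g
        using bound[of "\<Union> (range A)" g] A prob_le_1[of "\<Union> (range A)"] by (force intro: order_trans)
    next
      fix \<epsilon> :: real assume \<epsilon>: "\<epsilon> > 0"
      have "(\<lambda>i. prob (A i)) sums prob (\<Union> (range A))"
        using union A by (intro finite_measure_UNION) auto
      then have "(\<lambda>n. \<Sum>i<n. prob (A i)) \<longlonglongrightarrow> prob (\<Union> (range A))" by (simp add: sums_def)
      from LIMSEQ_D[OF this \<epsilon>] obtain n where n: "\<bar>(\<Sum>i<n. prob (A i)) - prob (\<Union> (range A))\<bar> < \<epsilon>"
        by auto
      define F where "F = (\<Union>i<n. A i)"
      define T where "T = \<Union> (range A) - F"
      have F: "F \<in> sets M" and T: "T \<in> sets M" using A by (auto simp: F_def T_def)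
      have FT: "F \<union> T = \<Union> (range A)" "F \<inter> T = {}" by (auto simp: F_def T_def)
      have "prob F = (\<Sum>i<n. prob (A i))"
        unfolding F_def using A union by (intro finite_measure_finite_Union) (auto simp: disjoint_family_on_def)
      moreover have "prob (\<Union> (range A)) = prob F + prob T"
        unfolding FT(1)[symmetric] using F T FT(2) by (rule finite_measure_Union)
      ultimately have pT: "prob T \<le> \<epsilon>" using n by linarith
      have DF: "D g (\<Union>i<m. A i) = (\<Sum>i<m. D g (A i))" for g m
      proof (induction m)
        case 0
        then show ?case by (simp add: D_empty)
      next
        case (Suc m)
        have "D g ((\<Union>i<m. A i) \<union> A m) = D g (\<Union>i<m. A i) + D g (A m)"
          using union A by (intro D_add) (auto simp: disjoint_family_on_def, metis IntI empty_iff nat_less_le)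
        moreover have "(\<Union>i<Suc m. A i) = (\<Union>i<m. A i) \<union> A m" by (auto simp: less_Suc_eq)
        ultimately show ?case using Suc by simp
      qed
      have le: "\<bar>D g (\<Union> (range A))\<bar> \<le> (\<Sum>i<n. \<bar>D g (A i)\<bar>) + \<epsilon>" for g
      proof -
        have "D g (\<Union> (range A)) = D g F + D g T" unfolding FT(1)[symmetric] using F T FT(2) by (rule D_add)
        moreover have "\<bar>D g F\<bar> \<le> (\<Sum>i<n. \<bar>D g (A i)\<bar>)" unfolding F_def DF by (rule sum_abs)
        moreover have "\<bar>D g T\<bar> \<le> \<epsilon>" using bound[OF T, of g] pT by simp
        ultimately show ?thesis by linarith
      qed
      have b1: "\<bar>D g (A i)\<bar> \<le> 1" for g i using bound[OF A, of g i] prob_le_1[of "A i"] by linarith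
      show "\<exists>h K. h \<in> borel_measurable borel \<and> (\<forall>g. \<bar>h g\<bar> \<le> K) \<and> cesaro_null h \<and>
          (\<forall>g. \<bar>D g (\<Union> (range A))\<bar> \<le> h g + \<epsilon>)"
      proof (intro exI[of _ "\<lambda>g. \<Sum>i<n. \<bar>D g (A i)\<bar>"] exI[of _ "real n"] conjI allI le)
        show "(\<lambda>g. \<Sum>i<n. \<bar>D g (A i)\<bar>) \<in> borel_measurable borel"
          using A meas by (intro borel_measurable_sum borel_measurable_abs) auto
        show "\<bar>\<Sum>i<n. \<bar>D g (A i)\<bar>\<bar> \<le> real n" for g
          using sum_norm_bound[of "{..<n}" "\<lambda>i. \<bar>D g (A i)\<bar>" 1] b1 by simp
        show "cesaro_null (\<lambda>g. \<Sum>i<n. \<bar>D g (A i)\<bar>)"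
          using b1 A meas union by (intro cesaro_null_sum) auto
      qed
    qed auto
  qed
qed

lemma complement_defect: "w = p + a \<Longrightarrow> a - (1 - P) * w = - (p - P * w)" for w :: real
  by (simp add: algebra_simps)

lemma diff_abs_le: "0 \<le> a \<Longrightarrow> a \<le> c \<Longrightarrow> 0 \<le> b \<Longrightarrow> b \<le> c \<Longrightarrow> \<bar>a - b\<bar> \<le> (c::real)"
  by linarith

context poisson_pair
begin

definition shift_defect :: "real \<Rightarrow> real \<Rightarrow> (real \<times> real \<Rightarrow> real) set \<Rightarrow> (real \<times> real \<Rightarrow> real) set \<Rightarrow> real \<times> real \<Rightarrow> real" where
  "shift_defect u0 u1 A B g = prob (shift_action u0 u1 g -` A \<inter> B) - prob A * prob B"

lemma shift_defect_measurable:
  "A \<in> sets M \<Longrightarrow> B \<in> sets M \<Longrightarrow> shift_defect u0 u1 A B \<in> borel_measurable borel"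
  unfolding shift_defect_def[abs_def]
  by (intro borel_measurable_diff prob_shift_Int_measurable) auto

text \<open>Both terms of the difference lie between 0 and each of the two probabilities. The two
  bounds control tails of unions in the first and in the second argument respectively.\<close>

lemma shift_defect_bound:
  assumes "A \<in> sets M" "B \<in> sets M"
  shows "\<bar>shift_defect u0 u1 A B g\<bar> \<le> prob A" "\<bar>shift_defect u0 u1 A B g\<bar> \<le> prob B"
proof -
  have "prob (shift_action u0 u1 g -` A \<inter> B) \<le> prob (shift_action u0 u1 g -` A)"
    using assms by (intro finite_measure_mono shift_vimage_sets) auto
  then have 1: "prob (shift_action u0 u1 g -` A \<inter> B) \<le> prob A" using assms by (simp add: prob_shift_vimage)
  have 2: "prob (shift_action u0 u1 g -` A \<inter> B) \<le> prob B"
    using assms by (intro finite_measure_mono) auto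
  have 3: "prob A * prob B \<le> prob A" "prob A * prob B \<le> prob B"
    using mult_left_mono[of "prob B" 1 "prob A"] mult_right_mono[of "prob A" 1 "prob B"] by auto
  show "\<bar>shift_defect u0 u1 A B g\<bar> \<le> prob A" "\<bar>shift_defect u0 u1 A B g\<bar> \<le> prob B"
    unfolding shift_defect_def using 1 2 3 by (auto intro!: diff_abs_le)
qed

text \<open>When both forms of g exceed 2B, the shifted windows are disjoint from the others,
  lengths add, and the exponential makes the void events exactly independent. The remaining g lie in
  two strips of density zero.\<close>

lemma shift_defect_void_null:
  assumes U: "U \<in> open_windows" and W: "W \<in> open_windows"
  shows "cesaro_null (\<lambda>g. \<bar>shift_defect u0 u1 (void_event U) (void_event W) g\<bar>)"
proof -
  have "bounded (U False \<union> U True \<union> W False \<union> W True)" using U W by (auto simp: open_windows_def)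
  then obtain B where B: "\<And>x. x \<in> U False \<union> U True \<union> W False \<union> W True \<Longrightarrow> \<bar>x\<bar> \<le> B"
    unfolding bounded_iff by (metis real_norm_def)
  have B: "\<bar>x\<bar> \<le> B" if "x \<in> U i \<or> x \<in> W i" for x i using B[of x] that by (cases i) auto
  let ?h = "\<lambda>g. indicator {g. \<bar>ell u0 u1 False g\<bar> \<le> 2 * B} g + indicator {g. \<bar>ell u0 u1 True g\<bar> \<le> 2 * B} g :: real"
  have strip [measurable]: "{g. \<bar>ell u0 u1 i g\<bar> \<le> C} \<in> sets borel" for i C
    using linear_continuous_on[OF bounded_linear_ell[of u0 u1 i], of UNIV]
    by (intro borel_closed closed_Collect_le continuous_intros)
  have defect0: "shift_defect u0 u1 (void_event U) (void_event W) g = 0"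
    if g: "\<And>i. \<bar>ell u0 u1 i g\<bar> > 2 * B" for g
  proof -
    let ?U = "\<lambda>i. (+) (ell u0 u1 i g) ` U i"
    have disj: "?U i \<inter> W i = {}" for i
    proof -
      have "ell u0 u1 i g + x \<noteq> y" if "x \<in> U i" "y \<in> W i" for x y
        using B[of x i] B[of y i] that g[of i] by auto
      then show ?thesis by blast
    qed
    have tU: "?U \<in> open_windows" using U by (rule open_windows_translation)
    have fin: "emeasure lborel (V i) \<noteq> \<infinity>" "V i \<in> sets lborel" if "V \<in> open_windows" for V i
      using that emeasure_bounded_finite[of "V i"] by (auto simp: open_windows_def)
    have m: "measure lborel (?U i \<union> W i) = measure lborel (U i) + measure lborel (W i)" for i
      using measure_Union[OF fin(1)[OF tU, of i] fin(1)[OF W, of i] fin(2)[OF tU, of i] fin(2)[OF W, of i] disj]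
        U by (simp add: measure_lborel_translation open_windows_def)
    have "shift_action u0 u1 g -` void_event U \<inter> void_event W = void_event (\<lambda>i. ?U i \<union> W i)"
      by (auto simp: shift_action_void_iff void_event_Int[symmetric])
    then have "prob (shift_action u0 u1 g -` void_event U \<inter> void_event W) = exp (- (\<Sum>i\<in>UNIV. measure lborel (?U i \<union> W i)))"
      using prob_void[OF open_windows_Un[OF tU W]] by simp
    also have "\<dots> = prob (void_event U) * prob (void_event W)"
      unfolding prob_void[OF U] prob_void[OF W] m by (simp add: sum.distrib exp_add[symmetric])
    finally show ?thesis by (simp add: shift_defect_def)
  qed
  show ?thesis
  proof (rule cesaro_null_dominated[where K = 1])
    show "(\<lambda>g. \<bar>shift_defect u0 u1 (void_event U) (void_event W) g\<bar>) \<in> borel_measurable borel"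
      using U W by (intro borel_measurable_abs shift_defect_measurable void_event_sets)
    show le1: "\<bar>shift_defect u0 u1 (void_event U) (void_event W) g\<bar> \<le> 1" for g
      using order_trans[OF shift_defect_bound(1) prob_le_1] U W by (auto simp: void_event_sets)
    fix \<epsilon> :: real assume "\<epsilon> > 0"
    have "\<bar>shift_defect u0 u1 (void_event U) (void_event W) g\<bar> \<le> ?h g + \<epsilon>" for g
    proof (cases "\<forall>i. \<bar>ell u0 u1 i g\<bar> > 2 * B")
      case True
      then show ?thesis using defect0 \<open>\<epsilon> > 0\<close> by simp
    next
      case False
      then obtain i where "\<bar>ell u0 u1 i g\<bar> \<le> 2 * B" by (auto simp: not_less)
      then have "?h g \<ge> 1" by (cases i) (auto simp: indicator_def)
      then show ?thesis using le1[of g] \<open>\<epsilon> > 0\<close> by linarith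
    qed
    moreover have "cesaro_null ?h"
    proof (rule cesaro_null_add[where K = 1 and K' = 1, OF _ _ _ _ cesaro_null_strip cesaro_null_strip])
      show "indicat_real {g. \<bar>ell u0 u1 i g\<bar> \<le> 2 * B} \<in> borel_measurable borel" for i by measurable
      then show "indicat_real {g. \<bar>ell u0 u1 i g\<bar> \<le> 2 * B} \<in> borel_measurable borel" for i .
      show "\<bar>indicat_real {g. \<bar>ell u0 u1 i g\<bar> \<le> 2 * B} g\<bar> \<le> 1" for i g by (simp add: indicator_def)
      then show "\<bar>indicat_real {g. \<bar>ell u0 u1 i g\<bar> \<le> 2 * B} g\<bar> \<le> 1" for i g .
    qed
    moreover have "\<bar>?h g\<bar> \<le> 2" for g by (auto simp: indicator_def)
    moreover have "?h \<in> borel_measurable borel" by measurable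
    ultimately show "\<exists>h K. h \<in> borel_measurable borel \<and> (\<forall>g. \<bar>h g\<bar> \<le> K) \<and> cesaro_null h \<and>
       (\<forall>g. \<bar>shift_defect u0 u1 (void_event U) (void_event W) g\<bar> \<le> h g + \<epsilon>)"
      by blast
  qed auto
qed

text \<open>The Dynkin argument is run twice: first in A against a fixed void event, then in B
  against an arbitrary A.\<close>

lemma shift_defect_null:
  assumes A: "A \<in> sets M" and B: "B \<in> sets M"
  shows "cesaro_null (\<lambda>g. \<bar>shift_defect u0 u1 A B g\<bar>)"
proof -
  have 1: "cesaro_null (\<lambda>g. \<bar>shift_defect u0 u1 A (void_event W) g\<bar>)"
    if W: "W \<in> open_windows" and A: "A \<in> sets M" for A W
  proof (rule cesaro_null_dynkin[OF sets_M Int_stable_void space_M _ _ _ _ _ A])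
    let ?W = "void_event W"
    have Ws: "?W \<in> sets M" using W by (rule void_event_sets)
    fix g X assume X: "X \<in> sets M"
    show "(\<lambda>g. shift_defect u0 u1 X ?W g) \<in> borel_measurable borel"
      using shift_defect_measurable[OF X Ws] by simp
    show "\<bar>shift_defect u0 u1 X ?W g\<bar> \<le> prob X" by (rule shift_defect_bound(1)[OF X Ws])
    have e: "prob ?W = prob (shift_action u0 u1 g -` X \<inter> ?W) + prob (shift_action u0 u1 g -` (UNIV - X) \<inter> ?W)"
      using X Ws sets.compl_sets[OF X]
      by (subst finite_measure_Union[symmetric])
        (auto intro!: sets.Int shift_vimage_sets arg_cong[where f = prob])
    have "prob (UNIV - X) = 1 - prob X" using prob_compl[OF X] by simp
    then have "shift_defect u0 u1 (UNIV - X) ?W g = - shift_defect u0 u1 X ?W g"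
      unfolding shift_defect_def using complement_defect[OF e] by simp
    then show "\<bar>shift_defect u0 u1 (UNIV - X) ?W g\<bar> = \<bar>shift_defect u0 u1 X ?W g\<bar>" by simp
    fix Y assume Y: "Y \<in> sets M" "X \<inter> Y = {}"
    have "prob (shift_action u0 u1 g -` (X \<union> Y) \<inter> ?W) =
        prob (shift_action u0 u1 g -` X \<inter> ?W) + prob (shift_action u0 u1 g -` Y \<inter> ?W)"
      using X Y Ws
      by (subst finite_measure_Union[symmetric])
        (auto intro!: sets.Int shift_vimage_sets arg_cong[where f = prob])
    then show "shift_defect u0 u1 (X \<union> Y) ?W g = shift_defect u0 u1 X ?W g + shift_defect u0 u1 Y ?W g"
      using finite_measure_Union[OF X Y] by (simp add: shift_defect_def algebra_simps)
  next
    fix X assume "X \<in> void_event ` open_windows"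
    then show "cesaro_null (\<lambda>g. \<bar>shift_defect u0 u1 X (void_event W) g\<bar>)"
      using shift_defect_void_null W by blast
  qed
  show ?thesis
  proof (rule cesaro_null_dynkin[OF sets_M Int_stable_void space_M _ _ _ _ _ B, where D = "\<lambda>g X. shift_defect u0 u1 A X g"])
    fix g X assume X: "X \<in> sets M"
    show "(\<lambda>g. shift_defect u0 u1 A X g) \<in> borel_measurable borel"
      using shift_defect_measurable[OF A X] by simp
    show "\<bar>shift_defect u0 u1 A X g\<bar> \<le> prob X" by (rule shift_defect_bound(2)[OF A X])
    have sA: "shift_action u0 u1 g -` A \<in> sets M" using A by (rule shift_vimage_sets)
    have e: "prob (shift_action u0 u1 g -` A) =
        prob (shift_action u0 u1 g -` A \<inter> X) + prob (shift_action u0 u1 g -` A \<inter> (UNIV - X))"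
      using X sA sets.compl_sets[OF X]
      by (subst finite_measure_Union[symmetric]) (auto intro!: sets.Int arg_cong[where f = prob])
    have "prob (UNIV - X) = 1 - prob X" using prob_compl[OF X] by simp
    then have "shift_defect u0 u1 A (UNIV - X) g = - shift_defect u0 u1 A X g"
      unfolding shift_defect_def using complement_defect[OF e[unfolded prob_shift_vimage[OF A]], of "prob X"]
      by (simp add: mult.commute[of "prob A"])
    then show "\<bar>shift_defect u0 u1 A (UNIV - X) g\<bar> = \<bar>shift_defect u0 u1 A X g\<bar>" by simp
    fix Y assume Y: "Y \<in> sets M" "X \<inter> Y = {}"
    have "prob (shift_action u0 u1 g -` A \<inter> (X \<union> Y)) =
        prob (shift_action u0 u1 g -` A \<inter> X) + prob (shift_action u0 u1 g -` A \<inter> Y)"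
      using X Y sA
      by (subst finite_measure_Union[symmetric]) (auto intro!: sets.Int arg_cong[where f = prob])
    then show "shift_defect u0 u1 A (X \<union> Y) g = shift_defect u0 u1 A X g + shift_defect u0 u1 A Y g"
      using finite_measure_Union[OF X Y] by (simp add: shift_defect_def algebra_simps)
  next
    fix X assume "X \<in> void_event ` open_windows"
    then show "cesaro_null (\<lambda>g. \<bar>shift_defect u0 u1 A X g\<bar>)" using 1 A by blast
  qed
qed

lemma weakly_mixing_shift: "weakly_mixing M (shift_action u0 u1)"
  unfolding weakly_mixing_def
proof (intro conjI ballI mp_action_shift)
  fix A B assume "A \<in> sets M" "B \<in> sets M"
  from shift_defect_null[OF this, of u0 u1]
  show "((\<lambda>R. (1 / (2 * R)^2) *
           (LINT g : {g :: real \<times> real. max \<bar>fst g\<bar> \<bar>snd g\<bar> \<le> R} | lborel.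
              \<bar>measure M (shift_action u0 u1 g -` A \<inter> space M \<inter> B) - measure M A * measure M B\<bar>))
         \<longlongrightarrow> 0) at_top"
    by (simp add: cesaro_null_def sq_box_def shift_defect_def)
qed

end

section \<open>The multiscale velocity field\<close>

definition mollifier :: "real \<Rightarrow> real" where
  "mollifier = (SOME \<rho>. (\<forall>k. Ck_real k \<rho>) \<and> (\<forall>x. \<rho> x \<ge> 0) \<and> (\<forall>x. \<bar>x\<bar> > 1 \<longrightarrow> \<rho> x = 0) \<and>
       integral\<^sup>L lborel \<rho> = 1)"

lemma
  shows Ck_real_mollifier: "Ck_real k mollifier"
    and mollifier_nonneg: "mollifier x \<ge> 0"
    and mollifier_support: "\<bar>x\<bar> > 1 \<Longrightarrow> mollifier x = 0"
    and integral_mollifier: "integral\<^sup>L lborel mollifier = 1"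
  using someI_ex[OF mollifier_exists, folded mollifier_def] by auto

lemma continuous_mollifier: "continuous_on UNIV mollifier"
  using Ck_real_mollifier[of 0] by simp

lemma mollifier_borel [measurable]: "mollifier \<in> borel_measurable borel"
  using continuous_mollifier by (rule borel_measurable_continuous_onI)

lemma integral_mollifier_shift: "(LINT r|lborel. mollifier (r - s)) = 1"
  using lborel_integral_real_affine[of 1 mollifier "- s"] integral_mollifier by simp

definition gap_set :: "bool \<Rightarrow> real \<Rightarrow> (real \<times> real \<Rightarrow> real) \<Rightarrow> real set" where
  "gap_set i L \<omega> = {r. \<forall>s\<in>{r<..<r + L}. \<omega> (s, of_bool i) = 0}"

text \<open>The mollified indicator of the gap set, evaluated at the origin only. Other points are
  reached through the action, which amounts to translating the kernel; this yields smoothness in z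
  for each fixed \<omega>.\<close>

definition bump :: "bool \<Rightarrow> real \<Rightarrow> (real \<times> real \<Rightarrow> real) \<Rightarrow> real" where
  "bump i L \<omega> = (LINT r|lborel. mollifier r * indicator (gap_set i L \<omega>) r)"

text \<open>The condition r \<in> [q - L, p] says that (p, q) lies inside (r, r + L). The countable
  form gives Borel measurability in r and joint measurability in (\<omega>, r).\<close>

lemma gap_set_compl:
  "r \<notin> gap_set i L \<omega> \<longleftrightarrow> (\<exists>p\<in>\<rat>. \<exists>q\<in>\<rat>. r \<in> {q - L..p} \<and> \<omega> \<in> hit_event i {p<..<q})"
proof
  assume "r \<notin> gap_set i L \<omega>"
  then obtain s where s: "r < s" "s < r + L" "\<omega> (s, of_bool i) \<noteq> 0" by (auto simp: gap_set_def)
  obtain p where p: "p \<in> \<rat>" "r < p" "p < s" using Rats_dense_in_real[OF s(1)] by auto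
  obtain q where q: "q \<in> \<rat>" "s < q" "q < r + L" using Rats_dense_in_real[OF s(2)] by auto
  show "\<exists>p\<in>\<rat>. \<exists>q\<in>\<rat>. r \<in> {q - L..p} \<and> \<omega> \<in> hit_event i {p<..<q}"
    using p q s(3) by (intro bexI[of _ p] bexI[of _ q]) (auto simp: hit_event_def)
next
  assume "\<exists>p\<in>\<rat>. \<exists>q\<in>\<rat>. r \<in> {q - L..p} \<and> \<omega> \<in> hit_event i {p<..<q}"
  then obtain p q where pq: "r \<in> {q - L..p}" "\<omega> \<in> hit_event i {p<..<q}" by blast
  then obtain s where "p < s" "s < q" "\<omega> (s, of_bool i) \<noteq> 0"
    by (auto simp: hit_event_def)
  with pq(1) show "r \<notin> gap_set i L \<omega>" by (auto simp: gap_set_def intro!: bexI[of _ s])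
qed

lemma gap_set_borel [measurable]: "gap_set i L \<omega> \<in> sets borel"
proof -
  have "gap_set i L \<omega> = - (\<Union>p\<in>\<rat>. \<Union>q\<in>\<rat>. if \<omega> \<in> hit_event i {p<..<q} then {q - L..p} else {})"
  proof -
    have "r \<in> (\<Union>p\<in>\<rat>. \<Union>q\<in>\<rat>. if \<omega> \<in> hit_event i {p<..<q} then {q - L..p} else {}) \<longleftrightarrow> r \<notin> gap_set i L \<omega>" for r
      unfolding gap_set_compl by (auto split: if_splits)
    then show ?thesis by blast
  qed
  also have "\<dots> \<in> sets borel"
    by (intro borel_comp sets.countable_UN'[OF countable_rat] image_subsetI) auto
  finally show ?thesis .
qed

lemma gap_set_shift: "r \<in> gap_set i L (shift_action u0 u1 g \<omega>) \<longleftrightarrow> r + ell u0 u1 i g \<in> gap_set i L \<omega>"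
proof
  assume l: "r \<in> gap_set i L (shift_action u0 u1 g \<omega>)"
  have "\<omega> (s, of_bool i) = 0" if "s \<in> {r + ell u0 u1 i g<..<r + ell u0 u1 i g + L}" for s
  proof -
    have "s - ell u0 u1 i g \<in> {r<..<r + L}" using that by auto
    then have "shift_action u0 u1 g \<omega> (s - ell u0 u1 i g, of_bool i) = 0" using l by (simp add: gap_set_def del: shift_action_of_bool)
    then show ?thesis by simp
  qed
  then show "r + ell u0 u1 i g \<in> gap_set i L \<omega>" by (simp add: gap_set_def)
qed (auto simp: gap_set_def)

lemma bump_shift:
  "bump i L (shift_action u0 u1 g \<omega>) =
   (LINT r|lborel. mollifier (r - ell u0 u1 i g) * indicator (gap_set i L \<omega>) r)"
proof -
  let ?l = "ell u0 u1 i g"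
  have "(LINT r|lborel. mollifier (r - ?l) * indicator (gap_set i L \<omega>) r) =
      (LINT r|lborel. mollifier ((?l + 1 * r) - ?l) * indicator (gap_set i L \<omega>) (?l + 1 * r))"
    using lborel_integral_real_affine[of 1 "\<lambda>r. mollifier (r - ?l) * indicator (gap_set i L \<omega>) r" ?l] by simp
  also have "\<dots> = bump i L (shift_action u0 u1 g \<omega>)"
    unfolding bump_def
    by (intro Bochner_Integration.integral_cong refl) (auto simp: indicator_def gap_set_shift add.commute)
  finally show ?thesis by simp
qed

lemma smooth_bump: "Ck k (\<lambda>z. bump i L (shift_action u0 u1 z \<omega>))"
  unfolding bump_shift
  by (intro Ck_compose_linear[OF bounded_linear_ell] Ck_real_convolution gap_set_borel
      Ck_real_mollifier mollifier_support)

lemma bump_bounds: "0 \<le> bump i L \<omega>" "bump i L \<omega> \<le> 1"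
proof -
  show "0 \<le> bump i L \<omega>"
    unfolding bump_def by (intro Bochner_Integration.integral_nonneg) (simp add: mollifier_nonneg)
  have "bump i L \<omega> \<le> integral\<^sup>L lborel mollifier"
    unfolding bump_def
    using integrable_mult_set[OF continuous_mollifier mollifier_support gap_set_borel, of 0 i L \<omega>]
      integrable_compact_support[OF continuous_mollifier mollifier_support]
    by (intro integral_mono) (auto simp: indicator_def mollifier_nonneg)
  then show "bump i L \<omega> \<le> 1" by (simp add: integral_mollifier)
qed

text \<open>The mollifier has radius 1, so every r within 1 of the form's value must start a gap;
  hence the margin of 1 on both sides.\<close>

lemma bump_eq_1:
  assumes "\<And>s. s \<in> {ell u0 u1 i g - 1<..<ell u0 u1 i g + 1 + L} \<Longrightarrow> \<omega> (s, of_bool i) = 0"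
  shows "bump i L (shift_action u0 u1 g \<omega>) = 1"
proof -
  have "mollifier (r - ell u0 u1 i g) * indicator (gap_set i L \<omega>) r = mollifier (r - ell u0 u1 i g)" for r
  proof (cases "\<bar>r - ell u0 u1 i g\<bar> \<le> 1")
    case True
    have "\<omega> (s, of_bool i) = 0" if "s \<in> {r<..<r + L}" for s
      by (rule assms) (use True that in \<open>simp add: abs_le_iff\<close>)
    then have "r \<in> gap_set i L \<omega>" by (simp add: gap_set_def)
    then show ?thesis by simp
  qed (simp add: mollifier_support)
  then show ?thesis unfolding bump_shift by (simp only: integral_mollifier_shift)
qed

text \<open>A single point s kills the bump on the whole region where the form is at most Z in
  absolute value: every |r| \<le> Z + 1 satisfies r < s < r + L.\<close>

lemma bump_eq_0:
  assumes "\<omega> \<in> hit_event i {Z + 1<..<L - Z - 1}" "\<bar>ell u0 u1 i g\<bar> \<le> Z"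
  shows "bump i L (shift_action u0 u1 g \<omega>) = 0"
proof -
  obtain s where s: "Z + 1 < s" "s < L - Z - 1" "\<omega> (s, of_bool i) \<noteq> 0"
    using assms(1) by (auto simp: hit_event_def)
  have "mollifier (r - ell u0 u1 i g) * indicator (gap_set i L \<omega>) r = 0" for r
  proof (cases "\<bar>r - ell u0 u1 i g\<bar> \<le> 1")
    case True
    then have "s \<in> {r<..<r + L}" using s assms(2) by auto
    then have "r \<notin> gap_set i L \<omega>" using s(3) by (auto simp: gap_set_def)
    then show ?thesis by simp
  qed (simp add: mollifier_support)
  then show ?thesis unfolding bump_shift by (simp only: Bochner_Integration.integral_zero)
qed

lemma (in poisson_pair) bump_measurable: "bump i L \<in> borel_measurable M"
proof -
  define R where "R = (\<Union>p\<in>\<rat>. \<Union>q\<in>\<rat>. hit_event i {p<..<q} \<times> {q - L..p})"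
  have "(\<omega>, r) \<in> R \<longleftrightarrow> r \<notin> gap_set i L \<omega>" for \<omega> r
    unfolding gap_set_compl R_def by auto
  then have "{z \<in> space (M \<Otimes>\<^sub>M lborel). snd z \<in> gap_set i L (fst z)} = space (M \<Otimes>\<^sub>M lborel) - R"
    by auto
  also have "\<dots> \<in> sets (M \<Otimes>\<^sub>M lborel)"
    unfolding R_def
    by (intro sets.compl_sets sets.countable_UN'[OF countable_rat] image_subsetI pair_measureI hit_event_sets) auto
  finally have [measurable]: "Measurable.pred (M \<Otimes>\<^sub>M lborel) (\<lambda>z. snd z \<in> gap_set i L (fst z))"
    by (simp add: pred_def)
  have "(\<lambda>z. mollifier (snd z) * (if snd z \<in> gap_set i L (fst z) then 1 else 0)) \<in> borel_measurable (M \<Otimes>\<^sub>M lborel)"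
    by measurable
  then have "(\<lambda>\<omega>. LINT r|lborel. mollifier r * (if r \<in> gap_set i L \<omega> then 1 else 0)) \<in> borel_measurable M"
    by (intro lborel.borel_measurable_lebesgue_integral) (simp add: case_prod_beta')
  moreover have "bump i L = (\<lambda>\<omega>. LINT r|lborel. mollifier r * (if r \<in> gap_set i L \<omega> then 1 else 0))"
    by (rule ext) (simp add: bump_def indicator_def of_bool_def)
  ultimately show ?thesis by simp
qed

section \<open>The recursive choice of scales\<close>

definition search_steps :: "real \<Rightarrow> nat \<Rightarrow> nat" where
  "search_steps L n = nat \<lceil>real n * exp (L + 3)\<rceil>"

text \<open>Upper end of a row of disjoint blocks that begins at n. A block has length L + 3: the
  gap L, a strip of width 1, and the mollifier margin 1 on each side. It is empty with probability
  exp(-(L + 3)), which explains the number of steps.\<close>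

definition search_width :: "real \<Rightarrow> nat \<Rightarrow> real" where
  "search_width L n = real n + real (search_steps L n) * (L + 3)"

text \<open>The recursion leaves, after removing from both ends the range of scale n and the
  mollifier margin 1, a window of length n + 1. It is empty with probability exp(-(n + 1)), which is
  summable.\<close>

fun gap_length :: "nat \<Rightarrow> real" where
  "gap_length 0 = 1"
| "gap_length (Suc n) = 2 * (real n ^ 2 * search_width (gap_length n) n) + 2 + real (Suc n)"

definition scale_width :: "nat \<Rightarrow> real" where
  "scale_width n = search_width (gap_length n) n"

text \<open>Up to time n W_n both linear forms are at most a constant times n W_n along a
  trajectory; the second factor n absorbs that constant.\<close>

definition scale_range :: "nat \<Rightarrow> real" where
  "scale_range n = real n ^ 2 * scale_width n"

lemma gap_length_Suc: "gap_length (Suc n) = 2 * scale_range n + 2 + real (Suc n)"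
  by (simp add: scale_range_def scale_width_def)

declare gap_length.simps(2) [simp del]

lemma gap_length_pos: "gap_length n > 0"
proof (induction n)
  case (Suc n)
  have "search_width (gap_length n) n \<ge> 0" using Suc by (simp add: search_width_def)
  then have "real n ^ 2 * search_width (gap_length n) n \<ge> 0" by simp
  then show ?case unfolding gap_length.simps(2) by linarith
qed simp

lemma scale_width_ge_n: "real n \<le> scale_width n"
  using gap_length_pos[of n] by (simp add: scale_width_def search_width_def)

lemma search_steps_ge: "real n * exp (L + 3) \<le> real (search_steps L n)"
  unfolding search_steps_def by (rule real_nat_ceiling_ge)

lemma scale_width_ge_length:
  assumes "n \<ge> 1"
  shows "gap_length n \<le> scale_width n"
proof -
  have "1 * 1 \<le> real n * exp (gap_length n + 3)"
    using assms gap_length_pos[of n] by (intro mult_mono) auto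
  then have "1 \<le> real (search_steps (gap_length n) n)" using search_steps_ge[of n "gap_length n"] by linarith
  then have "1 * (gap_length n + 3) \<le> real (search_steps (gap_length n) n) * (gap_length n + 3)"
    using gap_length_pos[of n] by (intro mult_right_mono) auto
  then show ?thesis by (simp add: scale_width_def search_width_def)
qed

lemma scale_range_ge_width: "n \<ge> 1 \<Longrightarrow> scale_width n \<le> scale_range n"
  using mult_right_mono[of 1 "real n ^ 2" "scale_width n"] scale_width_ge_n[of n]
  by (simp add: scale_range_def)

lemma scale_range_ge_n: "real n \<le> scale_range n"
proof (cases "n = 0")
  case True
  then show ?thesis by (simp add: scale_range_def)
next
  case False
  then show ?thesis using scale_range_ge_width[of n] scale_width_ge_n[of n] by simp
qed

lemma scale_range_mono: "m \<le> n \<Longrightarrow> scale_range m \<le> scale_range n"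
proof (rule lift_Suc_mono_le[of scale_range])
  fix n
  have "scale_range n \<ge> 0" using scale_range_ge_n[of n] by linarith
  then have "scale_range n \<le> gap_length (Suc n)" by (simp add: gap_length_Suc)
  also have "\<dots> \<le> scale_range (Suc n)"
    using scale_width_ge_length[of "Suc n"] scale_range_ge_width[of "Suc n"] by simp
  finally show "scale_range n \<le> scale_range (Suc n)" .
qed

text \<open>On any bounded set all sufficiently large scales are switched off, by
  \<open>bump_eq_0\<close>. Quantifying over every N makes the set exactly shift invariant, since a
  shift changes the margins by a bounded amount.\<close>

definition good_configs :: "(real \<times> real \<Rightarrow> real) set" where
  "good_configs = {\<omega>. \<forall>N::nat. \<exists>n0. \<forall>n\<ge>n0. \<omega> \<in> hit_event (odd n) {real N<..<gap_length n - real N}}"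

lemma good_configs_shift:
  assumes "\<omega> \<in> good_configs"
  shows "shift_action u0 u1 g \<omega> \<in> good_configs"
  unfolding good_configs_def
proof (intro CollectI allI)
  fix N :: nat
  obtain K :: nat where K: "\<bar>ell u0 u1 True g\<bar> + \<bar>ell u0 u1 False g\<bar> \<le> real K"
    using real_arch_simple by blast
  have K: "\<bar>ell u0 u1 i g\<bar> \<le> real K" for i using K by (cases i) auto
  obtain n0 where n0: "\<And>n. n \<ge> n0 \<Longrightarrow> \<omega> \<in> hit_event (odd n) {real (N + K)<..<gap_length n - real (N + K)}"
    using assms unfolding good_configs_def by blast
  have "shift_action u0 u1 g \<omega> \<in> hit_event (odd n) {real N<..<gap_length n - real N}" if n: "n \<ge> n0" for n
  proof -
    obtain s where s: "real (N + K) < s" "s < gap_length n - real (N + K)" "\<omega> (s, of_bool (odd n)) \<noteq> 0"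
      using n0[OF n] by (auto simp: hit_event_def simp del: of_nat_add)
    have "s - ell u0 u1 (odd n) g \<in> {real N<..<gap_length n - real N}"
      using s(1,2) K[of "odd n"] by auto
    moreover have "shift_action u0 u1 g \<omega> (s - ell u0 u1 (odd n) g, of_bool (odd n)) \<noteq> 0"
      unfolding shift_action_of_bool using s(3) by simp
    ultimately show ?thesis unfolding hit_event_def by blast
  qed
  then show "\<exists>n0. \<forall>n\<ge>n0. shift_action u0 u1 g \<omega> \<in> hit_event (odd n) {real N<..<gap_length n - real N}"
    by blast
qed

lemma good_configs_shift_iff: "shift_action u0 u1 g \<omega> \<in> good_configs \<longleftrightarrow> \<omega> \<in> good_configs"
  using good_configs_shift[of \<omega> u0 u1 g] good_configs_shift[of "shift_action u0 u1 g \<omega>" u0 u1 "- g"]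
    shift_action_add[of u0 u1 "- g" g \<omega>] by (auto simp: shift_action_0)

definition speed :: "real \<Rightarrow> real \<Rightarrow> nat \<Rightarrow> real" where
  "speed u0 u1 n = (if odd n then u1 else u0)"

definition scale_bump :: "nat \<Rightarrow> (real \<times> real \<Rightarrow> real) \<Rightarrow> real" where
  "scale_bump n \<omega> = bump (odd n) (gap_length n) \<omega>"

text \<open>The newest scale enters last as a convex combination: bump 1 erases all smaller scales,
  bump 0 leaves the stage unchanged, and the values stay in [u0, u1].\<close>

primrec partial_velocity :: "real \<Rightarrow> real \<Rightarrow> nat \<Rightarrow> (real \<times> real \<Rightarrow> real) \<Rightarrow> real" where
  "partial_velocity u0 u1 0 \<omega> = u0"
| "partial_velocity u0 u1 (Suc n) \<omega> =
    (1 - scale_bump n \<omega>) * partial_velocity u0 u1 n \<omega> + scale_bump n \<omega> * speed u0 u1 n"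

text \<open>On good configurations the sequence is eventually constant. Elsewhere the default
  applies along the entire orbit, by shift invariance, so the realization is constant and hence
  smooth there too.\<close>

definition velocity :: "real \<Rightarrow> real \<Rightarrow> (real \<times> real \<Rightarrow> real) \<Rightarrow> real" where
  "velocity u0 u1 \<omega> = (if \<omega> \<in> good_configs then lim (\<lambda>n. partial_velocity u0 u1 n \<omega>) else u0)"

lemma partial_velocity_eventually_const:
  assumes "\<And>m. m \<ge> n \<Longrightarrow> scale_bump m \<omega> = 0" and "m \<ge> n"
  shows "partial_velocity u0 u1 m \<omega> = partial_velocity u0 u1 n \<omega>"
  using assms(2) by (induction m rule: dec_induct) (auto simp: assms(1))

lemma velocity_eq_partial:
  assumes "\<omega> \<in> good_configs" "\<And>m. m \<ge> n \<Longrightarrow> scale_bump m \<omega> = 0"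
  shows "velocity u0 u1 \<omega> = partial_velocity u0 u1 n \<omega>"
proof -
  have "(\<lambda>m. partial_velocity u0 u1 m \<omega>) \<longlonglongrightarrow> partial_velocity u0 u1 n \<omega>"
    by (intro tendsto_eventually eventually_sequentiallyI[of n] partial_velocity_eventually_const assms(2))
  then show ?thesis using assms(1) by (simp add: velocity_def limI)
qed

lemma velocity_on_barrier:
  assumes "\<omega> \<in> good_configs" "scale_bump n \<omega> = 1" "\<And>m. m > n \<Longrightarrow> scale_bump m \<omega> = 0"
  shows "velocity u0 u1 \<omega> = speed u0 u1 n"
  using velocity_eq_partial[of \<omega> "Suc n" u0 u1] assms by simp

lemma partial_velocity_bounds:
  assumes "u0 \<le> u1"
  shows "partial_velocity u0 u1 n \<omega> \<in> {u0..u1}"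
proof (induction n)
  case (Suc n)
  let ?b = "scale_bump n \<omega>" and ?p = "partial_velocity u0 u1 n \<omega>" and ?s = "speed u0 u1 n"
  have b: "0 \<le> ?b" "?b \<le> 1" using bump_bounds by (auto simp: scale_bump_def)
  have s: "?s \<in> {u0..u1}" using assms by (auto simp: speed_def)
  have "convex {u0..u1}" by simp
  from convexD[OF this Suc s, of "1 - ?b" ?b] show ?case using b by simp
qed (use assms in simp)

lemma bounded_ell:
  obtains N :: nat where "\<And>i z. z \<in> ball z0 1 \<Longrightarrow> \<bar>ell u0 u1 i z\<bar> \<le> real N"
proof -
  have "bounded (ell u0 u1 i ` ball z0 1)" for i
    by (intro bounded_linear_image bounded_ball bounded_linear_ell)
  then have "\<exists>B. \<forall>z\<in>ball z0 1. \<bar>ell u0 u1 i z\<bar> \<le> B" for i by (auto simp: bounded_iff)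
  then obtain B where B: "\<And>i z. z \<in> ball z0 1 \<Longrightarrow> \<bar>ell u0 u1 i z\<bar> \<le> B i" by metis
  obtain N :: nat where N: "max (B True) (B False) \<le> real N" using real_arch_simple by blast
  have "\<bar>ell u0 u1 i z\<bar> \<le> real N" if "z \<in> ball z0 1" for i z
    using B[OF that, of i] N by (cases i) auto
  then show thesis by (rule that)
qed

text \<open>One stage n works for the whole unit ball, which is the uniformity that
  \<open>Ck_local\<close> requires.\<close>

lemma scale_bump_locally_0:
  assumes "\<omega> \<in> good_configs"
  obtains n where "\<And>m z. m \<ge> n \<Longrightarrow> z \<in> ball z0 1 \<Longrightarrow> scale_bump m (shift_action u0 u1 z \<omega>) = 0"
proof -
  obtain N :: nat where N: "\<And>i z. z \<in> ball z0 1 \<Longrightarrow> \<bar>ell u0 u1 i z\<bar> \<le> real N"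
    using bounded_ell[of z0 u0 u1] by blast
  obtain n where n: "\<And>m. m \<ge> n \<Longrightarrow> \<omega> \<in> hit_event (odd m) {real (N + 1)<..<gap_length m - real (N + 1)}"
    using assms unfolding good_configs_def by blast
  have "scale_bump m (shift_action u0 u1 z \<omega>) = 0" if "m \<ge> n" "z \<in> ball z0 1" for m z
    unfolding scale_bump_def using n[OF that(1)] N[OF that(2)]
    by (intro bump_eq_0[of _ _ "real N"]) (auto simp: algebra_simps)
  then show thesis by (rule that)
qed

lemma velocity_bounds:
  assumes "u0 \<le> u1"
  shows "velocity u0 u1 \<omega> \<in> {u0..u1}"
proof (cases "\<omega> \<in> good_configs")
  case True
  obtain n where "\<And>m z. m \<ge> n \<Longrightarrow> z \<in> ball 0 1 \<Longrightarrow> scale_bump m (shift_action u0 u1 z \<omega>) = 0"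
    using scale_bump_locally_0[OF True] by blast
  from this[of _ 0] have "velocity u0 u1 \<omega> = partial_velocity u0 u1 n \<omega>"
    by (intro velocity_eq_partial[OF True]) (simp add: shift_action_0)
  then show ?thesis using partial_velocity_bounds[OF assms] by metis
next
  case False
  then show ?thesis using assms by (simp add: velocity_def)
qed

lemma Ck_partial_velocity: "Ck k (\<lambda>z. partial_velocity u0 u1 n (shift_action u0 u1 z \<omega>))"
proof (induction n)
  case (Suc n)
  have b: "Ck k (\<lambda>z. scale_bump n (shift_action u0 u1 z \<omega>))"
    unfolding scale_bump_def by (rule smooth_bump)
  have "Ck k (\<lambda>z. 1 + (- 1) * scale_bump n (shift_action u0 u1 z \<omega>))"
    by (intro Ck_add Ck_mult Ck_const b)
  then have "Ck k (\<lambda>z. 1 - scale_bump n (shift_action u0 u1 z \<omega>))" by simp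
  then show ?case unfolding partial_velocity.simps by (intro Ck_add Ck_mult Ck_const b Suc)
qed (simp add: Ck_const)

lemma smooth_velocity: "smooth_fun (\<lambda>z. velocity u0 u1 (shift_action u0 u1 z \<omega>))"
proof (cases "\<omega> \<in> good_configs")
  case True
  show ?thesis unfolding smooth_fun_def
  proof (intro allI Ck_local)
    fix k z0
    obtain n where n: "\<And>m z. m \<ge> n \<Longrightarrow> z \<in> ball z0 1 \<Longrightarrow> scale_bump m (shift_action u0 u1 z \<omega>) = 0"
      using scale_bump_locally_0[OF True] by blast
    show "\<exists>S h. open S \<and> z0 \<in> S \<and> Ck k h \<and> (\<forall>z\<in>S. velocity u0 u1 (shift_action u0 u1 z \<omega>) = h z)"
      using Ck_partial_velocity n True
      by (intro exI[of _ "ball z0 1"] exI[of _ "\<lambda>z. partial_velocity u0 u1 n (shift_action u0 u1 z \<omega>)"])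
        (auto intro!: velocity_eq_partial simp: good_configs_shift_iff)
  qed
next
  case False
  then show ?thesis by (simp add: velocity_def good_configs_shift_iff smooth_fun_def Ck_const)
qed

lemma (in poisson_pair) good_configs_sets: "good_configs \<in> sets M"
proof -
  have [measurable]: "hit_event (odd n) {real N<..<gap_length n - real N} \<in> sets M" for n N
    by (rule hit_event_sets) auto
  have "{\<omega> \<in> space M. \<forall>N::nat. \<exists>n0. \<forall>n. n \<ge> n0 \<longrightarrow> \<omega> \<in> hit_event (odd n) {real N<..<gap_length n - real N}} \<in> sets M"
    by measurable
  then show ?thesis by (simp add: good_configs_def)
qed

lemma (in poisson_pair) velocity_measurable: "velocity u0 u1 \<in> borel_measurable M"
proof -
  have [measurable]: "scale_bump n \<in> borel_measurable M" for n
    unfolding scale_bump_def[abs_def] by (rule bump_measurable)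
  have [measurable]: "partial_velocity u0 u1 n \<in> borel_measurable M" for n
  proof (induction n)
    case (Suc n)
    have "(\<lambda>\<omega>. (1 - scale_bump n \<omega>) * partial_velocity u0 u1 n \<omega> + scale_bump n \<omega> * speed u0 u1 n) \<in> borel_measurable M"
      using Suc by measurable
    then show ?case by (simp cong: measurable_cong)
  qed simp
  note good_configs_sets[measurable]
  show ?thesis unfolding velocity_def[abs_def] by measurable
qed

section \<open>Trapping of trajectories\<close>

text \<open>Independence of hits is extracted from void probabilities alone. Carrying a void event U
  through the induction allows the last interval to be peeled off: hitting it is the complement of
  enlarging U by it.\<close>

lemma (in poisson_pair) prob_hit_all:
  assumes I: "\<And>j. open (I j)" "\<And>j. bounded (I j)" "\<And>j. measure lborel (I j) = l"
    and disj: "\<And>j j'. j < j' \<Longrightarrow> I j \<inter> I j' = {}"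
  shows "U \<in> open_windows \<Longrightarrow> (\<And>j. j < k \<Longrightarrow> I j \<inter> U i = {}) \<Longrightarrow>
    prob ((\<Inter>j<k. hit_event i (I j)) \<inter> void_event U) = (1 - exp (- l)) ^ k * prob (void_event U)"
proof (induction k arbitrary: U)
  case 0
  then show ?case by simp
next
  case (Suc k)
  let ?X = "\<Inter>j<k. hit_event i (I j)"
  \<comment> \<open>Merging the missed interval into the window keeps the event in the form covered
    by the induction hypothesis, at the price of a factor exp(-l).\<close>
  define U' where "U' = U(i := U i \<union> I k)"
  have U': "U' \<in> open_windows" using Suc.prems(1) I by (auto simp: U'_def open_windows_def)
  have dU: "I j \<inter> U i = {}" if "j < k" for j using Suc.prems(2)[of j] that by simp
  have dU': "I j \<inter> U' i = {}" if "j < k" for j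
    using dU[OF that] disj[OF that] by (auto simp: U'_def)
  have V': "void_event U' = void_event U - hit_event i (I k)"
    unfolding void_event_def hit_event_def U'_def by (auto split: if_splits)
  have "measure lborel (U i \<union> I k) = measure lborel (U i) + l"
    unfolding I(3)[symmetric, of k]
    using Suc.prems emeasure_bounded_finite[of "U i"] emeasure_bounded_finite[of "I k"] I
    by (intro measure_Union) (auto simp: open_windows_def)
  then have "(\<Sum>j\<in>UNIV. measure lborel (U' j)) = (\<Sum>j\<in>UNIV. measure lborel (U j)) + l"
    by (cases i) (auto simp: UNIV_bool U'_def)
  then have pV': "prob (void_event U') = exp (- l) * prob (void_event U)"
    by (simp add: prob_void[OF U'] prob_void[OF Suc.prems(1)] exp_add[symmetric])
  have X: "?X \<inter> void_event W \<in> sets M" if "W \<in> open_windows" for W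
  proof (cases "k = 0")
    case False
    then show ?thesis
      using I that by (intro sets.Int sets.finite_INT hit_event_sets void_event_sets) auto
  qed (use that in \<open>simp add: void_event_sets\<close>)
  have "(\<Inter>j<Suc k. hit_event i (I j)) \<inter> void_event U = (?X \<inter> void_event U) - (?X \<inter> void_event U')"
    unfolding V' by (auto simp: less_Suc_eq)
  then have "prob ((\<Inter>j<Suc k. hit_event i (I j)) \<inter> void_event U) =
      prob (?X \<inter> void_event U) - prob (?X \<inter> void_event U')"
    using finite_measure_Diff[OF X[OF Suc.prems(1)] X[OF U']] by (auto simp: V')
  also have "\<dots> = (1 - exp (- l)) ^ k * prob (void_event U) - (1 - exp (- l)) ^ k * prob (void_event U')"
    using Suc.IH[OF Suc.prems(1) dU] Suc.IH[OF U' dU'] by simp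
  finally show ?case by (simp add: pV' algebra_simps)
qed

section \<open>Almost sure existence of gaps and absence of larger ones\<close>

definition search_block :: "nat \<Rightarrow> nat \<Rightarrow> real set" where
  "search_block n j = {real n + real j * (gap_length n + 3)<..<real n + real (Suc j) * (gap_length n + 3)}"

definition no_gap_event :: "nat \<Rightarrow> (real \<times> real \<Rightarrow> real) set" where
  "no_gap_event n = (\<Inter>j<search_steps (gap_length n) n. hit_event (odd n) (search_block n j))"

lemma (in poisson_pair) no_gap_event_sets: "no_gap_event n \<in> sets M"
proof (cases "search_steps (gap_length n) n = 0")
  case True
  then show ?thesis using sets.top[of M] by (simp add: no_gap_event_def)
next
  case False
  then show ?thesis unfolding no_gap_event_def search_block_def
    by (intro sets.finite_INT hit_event_sets) auto
qed

text \<open>With block length l and k \<ge> n exp(l) blocks, (1 - exp(-l))^k \<le> exp(-k exp(-l))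
  \<le> exp(-n).\<close>

lemma (in poisson_pair) prob_no_gap_event: "prob (no_gap_event n) \<le> exp (- real n)"
proof -
  let ?l = "gap_length n + 3" and ?k = "search_steps (gap_length n) n"
  have l: "?l > 0" using gap_length_pos[of n] by simp
  have "search_block n j \<inter> search_block n j' = {}" if "j < j'" for j j'
  proof -
    have "real (Suc j) * ?l \<le> real j' * ?l" using that l by (intro mult_right_mono) auto
    then show ?thesis unfolding search_block_def by auto
  qed
  moreover have "measure lborel (search_block n j) = ?l" for j
    using l by (simp add: search_block_def algebra_simps)
  ultimately have "prob ((\<Inter>j<?k. hit_event (odd n) (search_block n j)) \<inter> void_event (\<lambda>_. {})) =
      (1 - exp (- ?l)) ^ ?k * prob (void_event (\<lambda>_. {}))"
    by (intro prob_hit_all) (auto simp: search_block_def open_windows_def)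
  then have "prob (no_gap_event n) = (1 - exp (- ?l)) ^ ?k"
    using prob_space by (simp add: no_gap_event_def void_event_empty)
  also have "\<dots> \<le> exp (- exp (- ?l)) ^ ?k"
    using l exp_ge_add_one_self[of "- exp (- ?l)"] by (intro power_mono) auto
  also have "\<dots> = exp (- (real ?k * exp (- ?l)))" by (simp add: exp_of_nat_mult[symmetric])
  also have "\<dots> \<le> exp (- real n)"
  proof -
    have "real n * exp ?l * exp (- ?l) \<le> real ?k * exp (- ?l)"
      using search_steps_ge[of n "gap_length n"] by (intro mult_right_mono) auto
    then show ?thesis by (simp add: mult.assoc exp_add[symmetric])
  qed
  finally show ?thesis .
qed

text \<open>Here a is the lower edge of a strip [a, a + 1] on which the bump equals 1. It lies above
  n, hence eventually above any given starting height, and below W_n.\<close>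

definition wide_gap :: "nat \<Rightarrow> real \<Rightarrow> (real \<times> real \<Rightarrow> real) \<Rightarrow> bool" where
  "wide_gap n a \<omega> \<longleftrightarrow> real n \<le> a \<and> a \<le> scale_width n \<and>
     (\<forall>s\<in>{a - 1<..<a + 2 + gap_length n}. \<omega> (s, of_bool (odd n)) = 0)"

lemma wide_gap_exists:
  assumes "\<omega> \<notin> no_gap_event n"
  shows "\<exists>a. wide_gap n a \<omega>"
proof -
  define l where "l = gap_length n + 3"
  have l: "l > 3" using gap_length_pos[of n] by (simp add: l_def)
  obtain j where j: "j < search_steps (gap_length n) n" "\<omega> \<notin> hit_event (odd n) (search_block n j)"
    using assms by (auto simp: no_gap_event_def)
  \<comment> \<open>The shift by 1 makes a - 1 and a + 2 + L the two ends of block j.\<close>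
  define a where "a = real n + real j * l + 1"
  have "real (Suc j) * l \<le> real (search_steps (gap_length n) n) * l"
    using j(1) l by (intro mult_right_mono) auto
  moreover have "real (Suc j) * l = real j * l + l" by (simp add: algebra_simps)
  moreover have "scale_width n = real n + real (search_steps (gap_length n) n) * l"
    by (simp add: scale_width_def search_width_def l_def)
  ultimately have "a \<le> scale_width n" using l unfolding a_def by linarith
  moreover have "0 \<le> real j * l" using l by (intro mult_nonneg_nonneg) auto
  then have "real n \<le> a" unfolding a_def by linarith
  moreover have "{a - 1<..<a + 2 + gap_length n} = search_block n j"
    by (auto simp: a_def search_block_def l_def algebra_simps)
  ultimately show ?thesis using j(2) by (auto simp: wide_gap_def hit_event_def)
qed

text \<open>Controls scale n + 1 by the range of scale n: a point in this middle window makes the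
  bump of scale n + 1 vanish wherever its linear form is at most \<open>scale_range n\<close> in
  absolute value.\<close>

definition clear_scale :: "nat \<Rightarrow> (real \<times> real \<Rightarrow> real) \<Rightarrow> bool" where
  "clear_scale n \<omega> \<longleftrightarrow>
     \<omega> \<in> hit_event (odd (Suc n)) {scale_range n + 1<..<gap_length (Suc n) - scale_range n - 1}"

lemma (in poisson_pair) AE_wide_gap:
  "AE \<omega> in M. eventually (\<lambda>n. \<exists>a. wide_gap n a \<omega>) sequentially"
proof -
  have "summable (\<lambda>n. exp (- 1 :: real) ^ n)" by (rule summable_geometric) simp
  then have "summable (\<lambda>n. exp (- real n))" by (simp add: exp_of_nat_mult[symmetric])
  then have "summable (\<lambda>n. prob (no_gap_event n))"
    by (rule summable_comparison_test'[of _ 0]) (simp add: prob_no_gap_event)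
  then have "AE \<omega> in M. eventually (\<lambda>n. \<omega> \<in> space M - no_gap_event n) sequentially"
    by (intro borel_cantelli_AE1 no_gap_event_sets) (auto simp: emeasure_eq_measure)
  then show ?thesis
    by eventually_elim (auto elim!: eventually_mono intro: wide_gap_exists)
qed

lemma (in poisson_pair) AE_clear_scale:
  "AE \<omega> in M. eventually (\<lambda>n. clear_scale n \<omega>) sequentially"
proof -
  define U where "U n = (\<lambda>j. if j = odd (Suc n) then {scale_range n + 1<..<gap_length (Suc n) - scale_range n - 1} else {})" for n
  have U: "U n \<in> open_windows" for n by (auto simp: U_def open_windows_def)
  \<comment> \<open>The summand \<open>real (Suc n)\<close> in the recursion for the gap length is
    exactly what is left of the window.\<close>
  have "(\<Sum>j\<in>UNIV. measure lborel (U n j)) = real (Suc n)" for n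
    by (cases "odd n") (auto simp: U_def UNIV_bool gap_length_Suc)
  then have p: "prob (void_event (U n)) = exp (- 1) ^ Suc n" for n
    by (simp only: prob_void[OF U] exp_of_nat_mult[symmetric]) simp
  have "summable (\<lambda>n. exp (- 1 :: real) ^ Suc n)" by (subst summable_Suc_iff) (rule summable_geometric, simp)
  then have "summable (\<lambda>n. prob (void_event (U n)))" by (simp only: p)
  then have "AE \<omega> in M. eventually (\<lambda>n. \<omega> \<in> space M - void_event (U n)) sequentially"
    by (intro borel_cantelli_AE1 void_event_sets U) (auto simp: emeasure_eq_measure)
  moreover have "clear_scale n \<omega> \<longleftrightarrow> \<omega> \<notin> void_event (U n)" for n \<omega>
    by (simp only: clear_scale_def hit_event_eq U_def Compl_iff)
  ultimately show ?thesis by simp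
qed

lemma good_configs_of_clear_scale:
  assumes "eventually (\<lambda>n. clear_scale n \<omega>) sequentially"
  shows "\<omega> \<in> good_configs"
  unfolding good_configs_def
proof (intro CollectI allI)
  fix N :: nat
  obtain n1 where n1: "\<And>n. n \<ge> n1 \<Longrightarrow> clear_scale n \<omega>"
    using assms by (auto simp: eventually_sequentially)
  have "\<omega> \<in> hit_event (odd m) {real N<..<gap_length m - real N}" if m: "m \<ge> Suc (max n1 N)" for m
  proof -
    obtain n where n: "m = Suc n" "n \<ge> n1" "n \<ge> N" using m by (cases m) auto
    have "real N \<le> scale_range n" using scale_range_ge_n[of n] n(3) by linarith
    then have "{scale_range n + 1<..<gap_length m - scale_range n - 1} \<subseteq> {real N<..<gap_length m - real N}"
      by auto
    then show ?thesis using n1[OF n(2)] unfolding clear_scale_def n(1) hit_event_def by blast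
  qed
  then show "\<exists>n0. \<forall>n\<ge>n0. \<omega> \<in> hit_event (odd n) {real N<..<gap_length n - real N}" by blast
qed

text \<open>Scale n is fully on in the strip. Each scale k + 1 above n is off by
  \<open>clear_scale k\<close>, whose range is at least that of n by monotonicity.\<close>

lemma velocity_on_wide_gap:
  assumes clear: "\<And>m. m \<ge> n \<Longrightarrow> clear_scale m \<omega>" and gap: "wide_gap n a \<omega>"
    and range: "\<And>i. \<bar>ell u0 u1 i z\<bar> \<le> scale_range n" and strip: "ell u0 u1 (odd n) z \<in> {a..a + 1}"
  shows "velocity u0 u1 (shift_action u0 u1 z \<omega>) = speed u0 u1 n"
proof (rule velocity_on_barrier)
  show "shift_action u0 u1 z \<omega> \<in> good_configs"
    using clear by (intro good_configs_shift good_configs_of_clear_scale eventually_sequentiallyI)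
  show "scale_bump n (shift_action u0 u1 z \<omega>) = 1"
    unfolding scale_bump_def using gap strip by (intro bump_eq_1) (auto simp: wide_gap_def)
  fix m assume "m > n"
  then obtain k where k: "m = Suc k" "k \<ge> n" by (cases m) auto
  have "\<bar>ell u0 u1 (odd m) z\<bar> \<le> scale_range k"
    using range scale_range_mono[OF k(2)] order_trans by blast
  then show "scale_bump m (shift_action u0 u1 z \<omega>) = 0"
    unfolding scale_bump_def k(1) using clear[OF k(2)]
    by (intro bump_eq_0) (auto simp: clear_scale_def)
qed

section \<open>Deterministic analysis of a single trajectory\<close>

lemma mono_of_derivative_nonneg:
  fixes y :: "real \<Rightarrow> real"
  assumes d: "\<And>t. t \<ge> t0 \<Longrightarrow> (y has_real_derivative y' t) (at t within {t0..})"
    and nn: "\<And>t. t \<ge> t0 \<Longrightarrow> y' t \<ge> 0" and st: "t0 \<le> s" "s \<le> t"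
  shows "y s \<le> y t"
proof (cases "s = t")
  case False
  have "\<exists>\<xi>\<in>{s<..<t}. y t - y s = y' \<xi> * (t - s)"
  proof (rule mvt_simple)
    show "(y has_derivative (*) (y' r)) (at r within {s..t})" if "s \<le> r" "r \<le> t" for r
      using has_field_derivative_subset[OF d, of r "{s..t}"] that st by (auto simp: has_field_derivative_def)
  qed (use st False in simp)
  then show ?thesis using nn st by (smt (verit) greaterThanLessThan_iff mult_nonneg_nonneg)
qed simp

text \<open>A monotone function whose derivative vanishes while its value is in \<open>[a, a + 1]\<close> can never
  traverse that interval, so it stays below \<open>a\<close>.\<close>

lemma trapped_below:
  fixes y :: "real \<Rightarrow> real"
  assumes d: "\<And>t. t \<ge> t0 \<Longrightarrow> (y has_real_derivative y' t) (at t within {t0..})"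
    and nn: "\<And>t. t \<ge> t0 \<Longrightarrow> y' t \<ge> 0"
    and stop: "\<And>t. t0 \<le> t \<Longrightarrow> t \<le> T \<Longrightarrow> y t \<in> {a..a + 1} \<Longrightarrow> y' t = 0"
    and start: "y t0 \<le> a" and T: "t0 \<le> T"
  shows "y T \<le> a"
proof (rule ccontr)
  assume "\<not> y T \<le> a"
  then have aT: "a < y T" by simp
  have cont: "continuous_on {t0..T} y"
    by (rule DERIV_continuous_on[of _ _ y'], rule has_field_derivative_subset[OF d]) auto
  obtain t1 where t1: "t0 \<le> t1" "t1 \<le> T" "y t1 = a"
    using IVT'[of y t0 a T] start aT T cont by auto
  \<comment> \<open>Keeps the path between the two times inside the strip even if it never reaches a
    + 1.\<close>
  define b where "b = min (a + 1) (y T)"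
  have ab: "a < b" "b \<le> a + 1" "b \<le> y T" using aT by (auto simp: b_def)
  obtain t2 where t2: "t1 \<le> t2" "t2 \<le> T" "y t2 = b"
    using IVT'[of y t1 b T] t1 ab continuous_on_subset[OF cont, of "{t1..T}"] by auto
  have "t1 < t2" using t1 t2 ab by (cases "t1 = t2") auto
  then have "\<exists>\<xi>\<in>{t1<..<t2}. y t2 - y t1 = y' \<xi> * (t2 - t1)"
  proof (rule mvt_simple)
    show "(y has_derivative (*) (y' r)) (at r within {t1..t2})" if "t1 \<le> r" "r \<le> t2" for r
      using has_field_derivative_subset[OF d, of r "{t1..t2}"] that t1 by (auto simp: has_field_derivative_def)
  qed
  then obtain \<xi> where xi: "t1 < \<xi>" "\<xi> < t2" "y t2 - y t1 = y' \<xi> * (t2 - t1)" by auto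
  have "y t1 \<le> y \<xi>" "y \<xi> \<le> y t2"
    using mono_of_derivative_nonneg[OF d nn] xi t1 by auto
  then have "y' \<xi> = 0" using stop[of \<xi>] xi t1 t2 ab by auto
  then show False using xi(3) t1 t2 ab by simp
qed

lemma Liminf_eqI_real:
  fixes f :: "real \<Rightarrow> real"
  assumes lower: "\<And>e. e > 0 \<Longrightarrow> eventually (\<lambda>t. c - e < f t) at_top"
    and upper: "\<And>e. e > 0 \<Longrightarrow> frequently (\<lambda>t. f t < c + e) at_top"
  shows "Liminf at_top (\<lambda>t. ereal (f t)) = ereal c"
proof (rule antisym)
  show "ereal c \<le> Liminf at_top (\<lambda>t. ereal (f t))"
    unfolding le_Liminf_iff
  proof (intro allI impI)
    fix z assume z: "z < ereal c"
    obtain r where r: "z < ereal r" "ereal r < ereal c" using ereal_dense2[OF z] by blast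
    have "eventually (\<lambda>t. c - (c - r) < f t) at_top" using r(2) by (intro lower) simp
    then show "eventually (\<lambda>t. z < ereal (f t)) at_top"
      by (rule eventually_mono) (use r(1) in \<open>auto intro: less_trans\<close>)
  qed
  show "Liminf at_top (\<lambda>t. ereal (f t)) \<le> ereal c"
  proof (rule ccontr)
    assume "\<not> ?thesis"
    then have "ereal c < Liminf at_top (\<lambda>t. ereal (f t))" by simp
    then obtain r where r: "ereal c < ereal r" "ereal r < Liminf at_top (\<lambda>t. ereal (f t))"
      using ereal_dense2 by blast
    have "eventually (\<lambda>t. ereal r < ereal (f t)) at_top" using r(2) by (rule less_LiminfD)
    then have "eventually (\<lambda>t. \<not> f t < c + (r - c)) at_top" by (rule eventually_mono) simp
    then show False using upper[of "r - c"] r(1) by (simp add: frequently_def)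
  qed
qed

text \<open>The probabilistic input is reduced to two conditions on \<omega> that do not mention t0,
  x0 or x, so one null set serves all trajectories.\<close>

locale solution_path =
  fixes u0 u1 :: real and \<omega> :: "real \<times> real \<Rightarrow> real" and t0 x0 :: real and x :: "real \<Rightarrow> real"
  assumes u0: "0 \<le> u0" and u01: "u0 < u1"
    and solution: "is_solution (\<lambda>z. velocity u0 u1 (shift_action u0 u1 z \<omega>)) t0 x0 x"
    and gaps: "eventually (\<lambda>n. \<exists>a. wide_gap n a \<omega>) sequentially"
    and clear: "eventually (\<lambda>n. clear_scale n \<omega>) sequentially"
begin

definition height :: "bool \<Rightarrow> real \<Rightarrow> real" where
  "height i t = ell u0 u1 i (t, x t)"

definition drift :: "bool \<Rightarrow> real \<Rightarrow> real" where
  "drift i t = (let u = velocity u0 u1 (shift_action u0 u1 (t, x t) \<omega>) in if i then u1 - u else u - u0)"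

lemma height_derivative:
  assumes "t \<ge> t0"
  shows "(height i has_real_derivative drift i t) (at t within {t0..})"
proof -
  have x: "(x has_real_derivative velocity u0 u1 (shift_action u0 u1 (t, x t) \<omega>)) (at t within {t0..})"
    using solution assms by (simp add: is_solution_def)
  show ?thesis
    using x by (cases i) (auto simp: height_def[abs_def] ell_def drift_def Let_def intro!: derivative_eq_intros)
qed

lemma drift_nonneg: "drift i t \<ge> 0"
  using velocity_bounds[of u0 u1 "shift_action u0 u1 (t, x t) \<omega>"] u01
  by (auto simp: drift_def Let_def)

lemma height_mono: "t0 \<le> s \<Longrightarrow> s \<le> t \<Longrightarrow> height i s \<le> height i t"
  using mono_of_derivative_nonneg[OF height_derivative drift_nonneg] .

text \<open>The two heights add up to (u1 - u0) t and each stays above its initial value, so each is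
  bounded above through the other. T \<ge> 1 turns the initial data into a multiple of T.\<close>

lemma height_abs_le:
  assumes "t0 \<le> t" "t \<le> T" "1 \<le> T"
  shows "\<bar>height i t\<bar> \<le> (\<bar>x0\<bar> + 3 * u1 * \<bar>t0\<bar> + u1) * T"
proof -
  have x: "x t0 = x0" using solution by (simp add: is_solution_def)
  have 1: "x0 - u0 * t0 \<le> x t - u0 * t" "u1 * t0 - x0 \<le> u1 * t - x t"
    using height_mono[of t0 t False] height_mono[of t0 t True] assms x by (auto simp: height_def ell_def)
  have b: "\<bar>u0 * t0\<bar> \<le> u1 * \<bar>t0\<bar>" "\<bar>u1 * t0\<bar> \<le> u1 * \<bar>t0\<bar>"
    using u0 u01 by (auto simp: abs_mult intro: mult_right_mono)
  have "(u1 - u0) * (t - t0) \<le> u1 * (T + \<bar>t0\<bar>)"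
    using u0 u01 assms by (intro mult_mono) auto
  then have c: "u1 * t - u1 * t0 - u0 * t + u0 * t0 \<le> u1 * T + u1 * \<bar>t0\<bar>" by (simp add: algebra_simps)
  have "\<bar>height i t\<bar> \<le> \<bar>x0\<bar> + 3 * (u1 * \<bar>t0\<bar>) + u1 * T"
    using 1 b c by (cases i) (auto simp: height_def ell_def abs_le_iff)
  also have "\<dots> \<le> (\<bar>x0\<bar> + 3 * (u1 * \<bar>t0\<bar>)) * T + u1 * T"
    using assms(3) u0 u01 mult_left_mono[of 1 T "\<bar>x0\<bar> + 3 * (u1 * \<bar>t0\<bar>)"] by simp
  finally show ?thesis by (simp add: algebra_simps)
qed

text \<open>Up to time n W_n the trajectory stays within the range where the strip of scale n is not
  overridden, and it starts below that strip; it is therefore trapped below a \<le> W_n.\<close>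

lemma height_at_scale_time:
  "eventually (\<lambda>n. height (odd n) (real n * scale_width n) \<le> scale_width n) sequentially"
proof -
  obtain n1 where n1: "\<And>n. n \<ge> n1 \<Longrightarrow> (\<exists>a. wide_gap n a \<omega>) \<and> clear_scale n \<omega>"
    using eventually_conj[OF gaps clear] by (auto simp: eventually_sequentially)
  \<comment> \<open>C dominates the growth factor of the heights, both starting heights, |t0| and 1,
    so n \<ge> C settles all comparisons at once.\<close>
  define C where "C = \<bar>x0\<bar> + 3 * u1 * \<bar>t0\<bar> + u1 + \<bar>height True t0\<bar> + \<bar>height False t0\<bar> + \<bar>t0\<bar> + 1"
  obtain n2 :: nat where n2: "C \<le> real n2" using real_arch_simple by blast
  have "height (odd n) (real n * scale_width n) \<le> scale_width n" if n: "n \<ge> max n1 n2" for n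
  proof -
    have Cn: "C \<le> real n" using n n2 by linarith
    have pos: "0 \<le> u1 * \<bar>t0\<bar>" using u0 u01 by simp
    have C_ge: "\<bar>x0\<bar> + 3 * u1 * \<bar>t0\<bar> + u1 \<le> C" "1 \<le> C" "\<bar>t0\<bar> \<le> C"
      using pos u0 u01 unfolding C_def by linarith+
    have C_height: "height i t0 \<le> C" for i
    proof -
      have "height i t0 \<le> \<bar>height True t0\<bar> + \<bar>height False t0\<bar>" by (cases i) auto
      then show ?thesis using pos u0 u01 unfolding C_def by linarith
    qed
    have n1': "1 \<le> real n" using C_ge(2) Cn by linarith
    let ?T = "real n * scale_width n"
    have W: "real n \<le> scale_width n" by (rule scale_width_ge_n)
    have "real n * 1 \<le> ?T" using W n1' by (intro mult_left_mono) linarith+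
    then have T: "real n \<le> ?T" by simp
    obtain a where a: "wide_gap n a \<omega>" using n1[of n] n by auto
    have "height (odd n) ?T \<le> a"
    proof (rule trapped_below[OF height_derivative drift_nonneg])
      show "t0 \<le> ?T" using T Cn C_ge(3) by linarith
      show "height (odd n) t0 \<le> a" using a Cn C_height[of "odd n"] by (auto simp: wide_gap_def)
      fix t assume t: "t0 \<le> t" "t \<le> ?T" and strip: "height (odd n) t \<in> {a..a + 1}"
      have "\<bar>ell u0 u1 i (t, x t)\<bar> \<le> scale_range n" for i
      proof -
        have "\<bar>height i t\<bar> \<le> (\<bar>x0\<bar> + 3 * u1 * \<bar>t0\<bar> + u1) * ?T"
          using T n1' by (intro height_abs_le t) linarith
        also have "\<dots> \<le> real n * ?T" using C_ge(1) Cn T by (intro mult_right_mono) auto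
        finally show ?thesis by (simp add: height_def scale_range_def power2_eq_square mult.assoc)
      qed
      then have "velocity u0 u1 (shift_action u0 u1 (t, x t) \<omega>) = speed u0 u1 n"
        using n1 n strip by (intro velocity_on_wide_gap[OF _ a]) (auto simp: height_def)
      then show "drift (odd n) t = 0" by (simp add: drift_def speed_def)
    qed
    then show ?thesis using a by (simp add: wide_gap_def)
  qed
  then show ?thesis by (intro eventually_sequentiallyI[of "max n1 n2"])
qed

text \<open>Monotonicity suffices: the height never drops below its initial value, which is
  negligible against t. For the two forms this gives the lower and the upper asymptotic bound on the
  slope.\<close>

lemma eventually_height: "e > 0 \<Longrightarrow> eventually (\<lambda>t. - e < height i t / t) at_top"
proof -
  assume e: "e > 0"
  have "((\<lambda>t. height i t0 / t) \<longlongrightarrow> 0) at_top"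
    by (intro tendsto_divide_0[OF tendsto_const] filterlim_at_top_imp_at_infinity filterlim_ident)
  then have "eventually (\<lambda>t. - e < height i t0 / t) at_top" using e by (intro order_tendstoD) auto
  then show ?thesis using eventually_gt_at_top[of "max t0 0"]
  proof eventually_elim
    case (elim t)
    then have "height i t0 / t \<le> height i t / t" using height_mono[of t0 t i] by (intro divide_right_mono) auto
    then show ?case using elim by linarith
  qed
qed

text \<open>At time n W_n the height is at most W_n, so the quotient is at most 1/n along the n of
  the matching parity.\<close>

lemma frequently_height: "e > 0 \<Longrightarrow> frequently (\<lambda>t. height i t / t < e) at_top"
proof -
  assume e: "e > 0"
  obtain n1 where n1: "\<And>n. n \<ge> n1 \<Longrightarrow> height (odd n) (real n * scale_width n) \<le> scale_width n"
    using height_at_scale_time by (auto simp: eventually_sequentially)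
  show ?thesis unfolding frequently_def eventually_at_top_linorder
  proof
    assume "\<exists>N. \<forall>t\<ge>N. \<not> height i t / t < e"
    then obtain N where N: "\<And>t. t \<ge> N \<Longrightarrow> \<not> height i t / t < e" by blast
    obtain k :: nat where k: "max (1 / e + 1) (max (real n1) N) \<le> real k" using real_arch_simple by blast
    \<comment> \<open>The summand selects the parity whose barriers act on the form
      \<open>i\<close>.\<close>
    define n where "n = 2 * k + of_bool i"
    have odd: "odd n = i" by (cases i) (auto simp: n_def)
    have "real k \<le> real n" by (simp add: n_def)
    then have n: "1 / e + 1 \<le> real n" "real n1 \<le> real n" "N \<le> real n" using k by linarith+
    have n_pos: "real n \<ge> 1" using n(1) e by (smt (verit) zero_less_divide_iff)
    have W: "real n \<le> scale_width n" by (rule scale_width_ge_n)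
    let ?T = "real n * scale_width n"
    have "real n * 1 \<le> ?T" using W n_pos by (intro mult_left_mono) linarith+
    then have T: "N \<le> ?T" "?T > 0" using n n_pos by linarith+
    have "height i ?T / ?T \<le> scale_width n / ?T"
      using n1[of n] n(2) odd T(2) by (intro divide_right_mono) auto
    also have "\<dots> = 1 / real n" using W n_pos by simp
    also have "\<dots> < e" using n(1) n_pos e by (simp add: field_simps)
    finally show False using N[OF T(1)] by simp
  qed
qed

lemma Liminf_slope: "Liminf at_top (\<lambda>t. ereal (x t / t)) = ereal u0"
proof (rule Liminf_eqI_real)
  fix e :: real assume e: "e > 0"
  have eq: "eventually (\<lambda>t. height False t / t = x t / t - u0) at_top"
    using eventually_gt_at_top[of 0] by eventually_elim (simp add: height_def ell_def field_simps)
  show "eventually (\<lambda>t. u0 - e < x t / t) at_top"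
    using eventually_height[OF e, of False] eq by eventually_elim linarith
  show "frequently (\<lambda>t. x t / t < u0 + e) at_top"
    by (rule frequently_rev_mp[OF frequently_height[OF e, of False]])
      (use eq in eventually_elim, linarith)
qed

text \<open>The slope is u1 minus the quotient for the second form, so the lower-limit criterion is
  applied to the negated slope.\<close>

lemma Limsup_slope: "Limsup at_top (\<lambda>t. ereal (x t / t)) = ereal u1"
proof -
  have "Liminf at_top (\<lambda>t. ereal (- (x t / t))) = ereal (- u1)"
  proof (rule Liminf_eqI_real)
    fix e :: real assume e: "e > 0"
    have eq: "eventually (\<lambda>t. height True t / t = u1 - x t / t) at_top"
      using eventually_gt_at_top[of 0] by eventually_elim (simp add: height_def ell_def field_simps)
    show "eventually (\<lambda>t. - u1 - e < - (x t / t)) at_top"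
      using eventually_height[OF e, of True] eq by eventually_elim linarith
    show "frequently (\<lambda>t. - (x t / t) < - u1 + e) at_top"
      by (rule frequently_rev_mp[OF frequently_height[OF e, of True]])
        (use eq in eventually_elim, linarith)
  qed
  then show ?thesis
    using ereal_Liminf_uminus[of at_top "\<lambda>t. ereal (x t / t)"]
    by simp (metis ereal_uminus_uminus minus_minus uminus_ereal.simps(1))
qed

end

theorem theorem2:
  fixes u0 u1 :: real
  assumes "0 \<le> u0" and "u0 < u1"
  shows "\<exists>(M :: (real \<times> real \<Rightarrow> real) measure) T ubar.
           weakly_mixing M T \<and>
           ubar \<in> borel_measurable M \<and>
           (\<forall>\<omega>\<in>space M. smooth_fun (\<lambda>z. ubar (T z \<omega>))) \<and>
           (\<forall>\<omega>\<in>space M. \<forall>z. ubar (T z \<omega>) \<in> {u0..u1}) \<and>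
           (AE \<omega> in M. \<forall>t0 x0.
              (\<exists>x. is_solution (\<lambda>z. ubar (T z \<omega>)) t0 x0 x) \<and>
              (\<forall>x. is_solution (\<lambda>z. ubar (T z \<omega>)) t0 x0 x \<longrightarrow>
                  Liminf at_top (\<lambda>t. ereal (x t / t)) = ereal u0 \<and>
                  Limsup at_top (\<lambda>t. ereal (x t / t)) = ereal u1))"
proof -
  obtain M where "poisson_pair M" using poisson_pair_exists by blast
  then interpret poisson_pair M .
  have bounds: "velocity u0 u1 \<omega> \<in> {u0..u1}" for \<omega>
    using velocity_bounds assms by simp
  have "AE \<omega> in M. \<forall>t0 x0.
      (\<exists>x. is_solution (\<lambda>z. velocity u0 u1 (shift_action u0 u1 z \<omega>)) t0 x0 x) \<and>
      (\<forall>x. is_solution (\<lambda>z. velocity u0 u1 (shift_action u0 u1 z \<omega>)) t0 x0 x \<longrightarrow>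
          Liminf at_top (\<lambda>t. ereal (x t / t)) = ereal u0 \<and>
          Limsup at_top (\<lambda>t. ereal (x t / t)) = ereal u1)"
    using AE_wide_gap AE_clear_scale
  proof eventually_elim
    case (elim \<omega>)
    show ?case
    proof (intro allI conjI impI)
      fix t0 x0
      show "\<exists>x. is_solution (\<lambda>z. velocity u0 u1 (shift_action u0 u1 z \<omega>)) t0 x0 x"
      proof (rule smooth_bounded_solution_exists[OF smooth_velocity])
        show "\<bar>velocity u0 u1 (shift_action u0 u1 z \<omega>)\<bar> \<le> u1" for z
          using bounds[of "shift_action u0 u1 z \<omega>"] assms by auto
      qed
      fix x assume "is_solution (\<lambda>z. velocity u0 u1 (shift_action u0 u1 z \<omega>)) t0 x0 x"
      then interpret solution_path u0 u1 \<omega> t0 x0 x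
        using assms elim by unfold_locales auto
      show "Liminf at_top (\<lambda>t. ereal (x t / t)) = ereal u0" by (rule Liminf_slope)
      show "Limsup at_top (\<lambda>t. ereal (x t / t)) = ereal u1" by (rule Limsup_slope)
    qed
  qed
  then show ?thesis
    using weakly_mixing_shift velocity_measurable smooth_velocity bounds by blast
qed

end
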